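(* Consider the matrix-valued Allen--Cahn equation $$U_t+\kappa U=\mathcal L U+\mathcal N[U],\quad t\in(0,T],\ \mathbf x\in\Omega,\qquad U|_{t=0}=U_0,$$ with the periodic boundary condition and initial value $U_0\in\mathcal X_m$. If $\kappa\ge\max\{\tfrac32 m-1,\,2\}$, then this equation has a unique solution $U(t,\mathbf x)\in C([0,T];\mathcal X_m)$; in particular $\|U(t,\mathbf x)\|_F\le\sqrt m$ for all $t\in[0,T]$ and all $\mathbf x\in\overline\Omega$.
   Context: Let $m\ge2$ be an integer, $\Omega=[-\frac12,\frac12]^m$, $T>0$ finite, $\varepsilon>0$ and $\kappa>0$ constants. $\|\cdot\|_F$ is the Frobenius norm on $\mathbb R^{m\times m}$. $\mathcal X$ is the Banach space of continuous $\mathbb R^{m\times m}$-valued functions on $\overline\Omega$ satisfying the periodic boundary condition (i.e. whose periodic extension to $\mathbb R^m$ is continuous), with norm $\|W\|_{\mathcal X}=\max_{\mathbf x\in\overline\Omega}\|W(\mathbf x)\|_F$, and $\mathcal X_m=\{W\in\mathcal X:\ \|W(\mathbf x)\|_F\le\sqrt m\ \text{for all }\mathbf x\in\overline\Omega\}$. $\mathcal L=\varepsilon^2\Delta$ with periodic boundary condition, acting entrywise, and $e^{t\mathcal L}=e^{t\varepsilon^2\Delta}$ ($t\ge0$) is the corresponding periodic heat semigroup on $\mathcal X$, acting entrywise; $e^{t(\mathcal L-\kappa)}=e^{-\kappa t}e^{t\mathcal L}$. The nonlinearity acts pointwise in $\mathbf x$: $\mathcal N[U]=\kappa U+f(U)$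 with $f(U)=U-UU^{\mathrm T}U$. A solution in $C([0,T];\mathcal X_m)$ is understood through Duhamel's formula: $U(t)=e^{t(\mathcal L-\kappa)}U_0+\int_0^t e^{(t-s)(\mathcal L-\kappa)}\mathcal N[U(s)]\,ds$ for all $t\in[0,T]$. *)

theory Defs
  imports "HOL-Probability.Probability"
begin

section \<open>Definitions\<close>

definition Omega :: "(real^'n) set" where
  "Omega = cbox (\<chi> i. - (1/2)) (\<chi> i. 1/2)"

text \<open>A function on \<^term>\<open>Omega\<close> satisfying the periodic boundary condition is identified with
  its continuous periodic extension to the whole space (\<open>periodic_extension_unique\<close> below).
  Under this identification the maximum norm over \<^term>\<open>Omega\<close> is the norm of the type of
  bounded continuous functions (\<open>norm_periodic\<close>), and the norm of the value type
  \<^typ>\<open>real^'n^'n\<close> is the Frobenius norm (\<open>norm_matrix_eq_Frobenius\<close>).\<close>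

definition periodic_space :: "((real^'n) \<Rightarrow>\<^sub>C 'b::euclidean_space) set" where
  "periodic_space = {W. \<forall>x i. apply_bcontfun W (x + axis i 1) = apply_bcontfun W x}"

definition Xm :: "((real^'n) \<Rightarrow>\<^sub>C (real^'n^'n)) set" where
  "Xm = {W \<in> periodic_space. \<forall>x\<in>Omega. norm (W x) \<le> sqrt (real CARD('n))}"

definition heat_kernel :: "real \<Rightarrow> real \<Rightarrow> real^'n \<Rightarrow> real" where
  "heat_kernel D t z = exp (- (norm z)\<^sup>2 / (4 * D * t)) / sqrt (4 * pi * D * t) ^ CARD('n)"

text \<open>The semigroup generated by \<open>D\<Delta>\<close> with periodic boundary condition: convolution of the
  periodic extension with the Gauss--Weierstrass kernel on the whole space, which amounts to
  convolution over \<^term>\<open>Omega\<close> with the periodized kernel. The integral of a vector- or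
  matrix-valued function is the entrywise one. The lemmas \<open>heat_semigroup_periodic\<close>,
  \<open>heat_semigroup_linear\<close>, \<open>heat_semigroup_norm\<close>, \<open>heat_semigroup_law\<close>,
  \<open>heat_semigroup_continuous\<close> and \<open>heat_semigroup_generator\<close> below show that for \<open>D > 0\<close> this is a
  strongly continuous contraction semigroup on \<^term>\<open>periodic_space\<close> whose generator is \<open>D\<Delta>\<close>
  on the twice continuously differentiable periodic functions.\<close>

definition heat_semigroup ::
    "real \<Rightarrow> real \<Rightarrow> ((real^'n) \<Rightarrow>\<^sub>C 'b::euclidean_space) \<Rightarrow> ((real^'n) \<Rightarrow>\<^sub>C 'b)" where
  "heat_semigroup D t W =
     (if t = 0 then W
      else Bcontfun (\<lambda>x. LINT y|lborel. heat_kernel D t (x - y) *\<^sub>R W y))"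

definition exp_L_minus ::
    "real \<Rightarrow> real \<Rightarrow> real \<Rightarrow> ((real^'n) \<Rightarrow>\<^sub>C (real^'n^'n)) \<Rightarrow> ((real^'n) \<Rightarrow>\<^sub>C (real^'n^'n))" where
  "exp_L_minus \<epsilon> \<kappa> t W = exp (- \<kappa> * t) *\<^sub>R heat_semigroup (\<epsilon>\<^sup>2) t W"

definition f_AC :: "real^'n^'n \<Rightarrow> real^'n^'n" where
  "f_AC A = A - A ** transpose A ** A"

definition nonlin ::
    "real \<Rightarrow> ((real^'n) \<Rightarrow>\<^sub>C (real^'n^'n)) \<Rightarrow> ((real^'n) \<Rightarrow>\<^sub>C (real^'n^'n))" where
  "nonlin \<kappa> U = Bcontfun (\<lambda>x. \<kappa> *\<^sub>R U x + f_AC (U x))"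

text \<open>\<^term>\<open>U\<close> is a solution in \<open>C([0,T]; X\<^sub>m)\<close>, in the sense of Duhamel's formula. The integral is
  that of a function with values in the Banach space of bounded continuous functions; only the
  values of \<^term>\<open>U\<close> on \<^term>\<open>{0..T}\<close> matter.\<close>

definition AC_solution ::
    "real \<Rightarrow> real \<Rightarrow> real \<Rightarrow> ((real^'n) \<Rightarrow>\<^sub>C (real^'n^'n)) \<Rightarrow>
     (real \<Rightarrow> ((real^'n) \<Rightarrow>\<^sub>C (real^'n^'n))) \<Rightarrow> bool" where
  "AC_solution \<epsilon> \<kappa> T U\<^sub>0 U \<longleftrightarrow>
     continuous_on {0..T} U \<and> (\<forall>t\<in>{0..T}. U t \<in> Xm) \<and>
     (\<forall>t\<in>{0..T}. U t = exp_L_minus \<epsilon> \<kappa> t U\<^sub>0 +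
        integral {0..t} (\<lambda>s. exp_L_minus \<epsilon> \<kappa> (t - s) (nonlin \<kappa> (U s))))"


section \<open>The function spaces\<close>

lemma norm_matrix_eq_Frobenius:
  "norm (A :: real^'n^'m) = sqrt (\<Sum>i\<in>UNIV. \<Sum>j\<in>UNIV. (A $ i $ j)\<^sup>2)"
  by (simp add: norm_vec_def L2_set_def sum_nonneg)

lemma nonlin_apply: "apply_bcontfun (nonlin \<kappa> U) x = \<kappa> *\<^sub>R U x + f_AC (U x)"
proof -
  let ?g = "\<lambda>A::real^'n^'n. \<kappa> *\<^sub>R A + f_AC A"
  have g: "continuous_on S ?g" for S
    unfolding f_AC_def matrix_matrix_mult_def transpose_def
    by (intro continuous_intros)
  have "continuous_on UNIV (\<lambda>x. ?g (U x))"
    by (rule continuous_on_compose2[OF g[of UNIV]]) auto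
  moreover have "bounded (range (\<lambda>x. ?g (U x)))"
  proof (rule bounded_subset)
    show "bounded (?g ` cball 0 (norm U))"
      by (intro compact_imp_bounded compact_continuous_image g) simp
    show "range (\<lambda>x. ?g (U x)) \<subseteq> ?g ` cball 0 (norm U)" by (auto simp: norm_bounded)
  qed
  ultimately have "(\<lambda>x. ?g (U x)) \<in> bcontfun" by (simp add: bcontfun_def)
  then show ?thesis by (simp add: nonlin_def Bcontfun_inverse)
qed

lemma periodic_space_shift:
  fixes W :: "(real^'n) \<Rightarrow>\<^sub>C 'b::euclidean_space" and k :: "'n \<Rightarrow> int"
  assumes W: "W \<in> periodic_space"
  shows "W (x + (\<chi> i. of_int (k i))) = W x"
proof -
  have 1: "W (x + axis i (of_int n)) = W x" for x i n
  proof (induction n arbitrary: x rule: int_induct[where k=0])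
    case base then show ?case by (simp add: axis_def vec_eq_iff cong: if_cong) (simp add: zero_vec_def[symmetric])
  next
    case (step1 n)
    have "x + axis i (of_int (n + 1)) = (x + axis i (of_int n)) + axis i 1"
      by (simp add: vec_eq_iff axis_def)
    then have "W (x + axis i (of_int (n + 1))) = W (x + axis i (of_int n))"
      using W by (simp only: periodic_space_def mem_Collect_eq)
    then show ?case using step1 by simp
  next
    case (step2 n)
    have "x + axis i (of_int n) = (x + axis i (of_int (n - 1))) + axis i 1"
      by (simp add: vec_eq_iff axis_def)
    then have "W (x + axis i (of_int n)) = W (x + axis i (of_int (n - 1)))"
      using W by (simp only: periodic_space_def mem_Collect_eq)
    then show ?case using step2 by simp
  qed
  have 2: "W (x + (\<Sum>i\<in>S. axis i (of_int (k i)))) = W x" if "finite S" for S x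
    using that
  proof (induction S arbitrary: x)
    case (insert i S)
    then show ?case using 1 by (simp add: add.assoc[symmetric])
  qed simp
  have "(\<Sum>i\<in>UNIV. axis i (of_int (k i))) = (\<chi> i. (of_int (k i) :: real))"
    by (simp add: vec_eq_iff axis_def)
  then show ?thesis using 2[of UNIV x] by simp
qed

lemma periodic_space_Omega:
  fixes x :: "real^'n"
  obtains y where "y - x \<in> range (\<lambda>k. (\<chi> i. of_int (k i)))" "y \<in> (Omega :: (real^'n) set)"
proof
  let ?k = "\<lambda>i::'n. - \<lfloor>x $ i + 1/2\<rfloor>"
  show "(x + (\<chi> i. of_int (?k i))) - x \<in> range (\<lambda>k. (\<chi> i. of_int (k i)))"
    by (rule range_eqI[of _ _ ?k]) simp
  have "-1/2 \<le> x $ i - of_int \<lfloor>x $ i + 1/2\<rfloor> \<and> x $ i - of_int \<lfloor>x $ i + 1/2\<rfloor> \<le> 1/2" for i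
    by linarith
  then show "x + (\<chi> i. of_int (?k i)) \<in> Omega"
    by (simp add: Omega_def mem_box_cart)
qed

lemma norm_periodic:
  fixes W :: "(real^'n) \<Rightarrow>\<^sub>C 'b::euclidean_space"
  assumes W: "W \<in> periodic_space"
  shows "norm W = (SUP x\<in>Omega. norm (W x))"
proof (rule antisym)
  have bdd: "bdd_above ((\<lambda>x. norm (W x)) ` Omega)" by (auto intro!: bdd_aboveI norm_bounded)
  show "norm W \<le> (SUP x\<in>Omega. norm (W x))"
  proof (rule norm_bound)
    fix x :: "real^'n" obtain y k where "y - x = (\<chi> i. of_int (k i))" and y: "y \<in> Omega" 
      using periodic_space_Omega[of x] by blast
    then have "y = x + (\<chi> i. of_int (k i))" by (simp add: algebra_simps)
    then have "W x = W y" using periodic_space_shift[OF W] by metis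
    then show "norm (W x) \<le> (SUP x\<in>Omega. norm (W x))" using y bdd by (auto intro!: cSUP_upper)
  qed
  have "(0::real^'n) \<in> Omega" by (simp add: Omega_def mem_box_cart)
  then show "(SUP x\<in>Omega. norm (W x)) \<le> norm W"
    by (intro cSUP_least) (auto simp: norm_bounded)
qed

lemma periodic_modulus:
  fixes W :: "(real^'n) \<Rightarrow>\<^sub>C 'b::euclidean_space"
  assumes W: "W \<in> periodic_space" and e: "e > 0"
  shows "\<exists>C\<ge>0. \<forall>x v. norm (W (x + v) - W x) \<le> e + C * (norm v)\<^sup>2"
proof -
  have "bounded (Omega::(real^'n) set)" by (simp add: Omega_def)
  then obtain R where R: "\<And>y::real^'n. y \<in> Omega \<Longrightarrow> norm y \<le> R" by (auto simp: bounded_iff)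
  have "uniformly_continuous_on (cball 0 (R + 1)) W"
    by (intro compact_uniformly_continuous) auto
  then obtain d where d: "d > 0" "\<And>x y. x \<in> cball 0 (R + 1) \<Longrightarrow> y \<in> cball 0 (R+1) \<Longrightarrow> dist y x < d \<Longrightarrow> dist (W y) (W x) < e"
    using e unfolding uniformly_continuous_on_def by metis
  define r where "r = min d 1"
  have r: "r > 0" using d by (simp add: r_def)
  show ?thesis
  proof (intro exI[of _ "2 * norm W / r\<^sup>2"] conjI allI)
    fix x v
    show "norm (W (x + v) - W x) \<le> e + 2 * norm W / r\<^sup>2 * (norm v)\<^sup>2"
    proof (cases "norm v < r")
      case True
      obtain y k where yk: "y - x = (\<chi> i. of_int (k i))" and y: "y \<in> Omega"
        using periodic_space_Omega[of x] by blast
      then have y': "y = x + (\<chi> i. of_int (k i))" by (simp add: algebra_simps)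
      have Wx: "W x = W y" "W (x + v) = W (y + v)"
        using periodic_space_shift[OF W, of x k] periodic_space_shift[OF W, of "x + v" k]
        by (auto simp: y' algebra_simps)
      have "norm (y + v) \<le> R + 1"
        using R[OF y] True norm_triangle_ineq[of y v] unfolding r_def by linarith
      then have "dist (W (y + v)) (W y) < e"
        using R[OF y] True by (intro d(2)) (auto simp: r_def mem_cball_0 simp del: mem_cball, simp add: dist_norm)
      moreover have "2 * norm W / r\<^sup>2 * (norm v)\<^sup>2 \<ge> 0" by simp
      ultimately show ?thesis unfolding Wx dist_norm by linarith
    next
      case False
      then have "1 \<le> (norm v)\<^sup>2 / r\<^sup>2" using r by (simp add: field_simps power_mono)
      then have "2 * norm W * 1 \<le> 2 * norm W * ((norm v)\<^sup>2 / r\<^sup>2)" by (intro mult_left_mono) auto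
      moreover have "norm (W (x + v) - W x) \<le> 2 * norm W"
        using norm_triangle_ineq4[of "W (x+v)" "W x"] norm_bounded[of W x] norm_bounded[of W "x+v"] by linarith
      ultimately show ?thesis using e by simp
    qed
  qed simp
qed

text \<open>The argument below is the representative of \<open>x\<close> modulo the integer lattice in the half-open cell.\<close>

lemma periodic_extension_unique:
  fixes f :: "real^'n \<Rightarrow> 'b::euclidean_space"
  defines "wrap \<equiv> \<lambda>x::real^'n. \<chi> i. x $ i - of_int \<lfloor>x $ i + 1/2\<rfloor>"
  assumes f: "\<And>x. x \<in> Omega \<Longrightarrow> f (wrap x) = f x" and cont: "continuous_on UNIV (\<lambda>x. f (wrap x))"
  shows "\<exists>!W. W \<in> periodic_space \<and> (\<forall>x\<in>Omega. apply_bcontfun W x = f x)"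
proof (rule ex1I)
  have wO: "wrap x \<in> Omega" for x
  proof -
    have "-1/2 \<le> x $ i - of_int \<lfloor>x $ i + 1/2\<rfloor> \<and> x $ i - of_int \<lfloor>x $ i + 1/2\<rfloor> \<le> 1/2" for i
      by linarith
    then show ?thesis by (simp add: wrap_def Omega_def mem_box_cart)
  qed
  have wp: "wrap (x + axis i 1) = wrap x" for x i
  proof -
    have "\<lfloor>x $ i + 1 + 1 / 2\<rfloor> = \<lfloor>x $ i + 1 / 2\<rfloor> + 1" by linarith
    then show ?thesis by (simp add: wrap_def vec_eq_iff axis_def)
  qed
  have "(\<lambda>x. f (wrap x)) ` Omega = f ` Omega" using f by (auto simp: image_iff)
  moreover have "compact ((\<lambda>x. f (wrap x)) ` Omega)"
    by (intro compact_continuous_image continuous_on_subset[OF cont]) (auto simp: Omega_def)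
  ultimately have "bounded (f ` Omega)" by (simp add: compact_imp_bounded)
  then have "bounded (range (\<lambda>x. f (wrap x)))" by (rule bounded_subset) (use wO in auto)
  then have b: "(\<lambda>x. f (wrap x)) \<in> bcontfun" using cont by (simp add: bcontfun_def)
  show "Bcontfun (\<lambda>x. f (wrap x)) \<in> periodic_space \<and> (\<forall>x\<in>Omega. apply_bcontfun (Bcontfun (\<lambda>x. f (wrap x))) x = f x)"
    by (simp add: periodic_space_def Bcontfun_inverse[OF b] wp f)
  fix W :: "(real^'n) \<Rightarrow>\<^sub>C 'b"
  assume W: "W \<in> periodic_space \<and> (\<forall>x\<in>Omega. apply_bcontfun W x = f x)"
  show "W = Bcontfun (\<lambda>x. f (wrap x))"
  proof (rule bcontfun_eqI)
    fix x
    have "x = wrap x + (\<chi> i. of_int \<lfloor>x $ i + 1/2\<rfloor>)" by (simp add: wrap_def vec_eq_iff)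
    then have "W x = W (wrap x)" using periodic_space_shift W by metis
    then show "W x = Bcontfun (\<lambda>x. f (wrap x)) x" using W wO by (simp add: Bcontfun_inverse[OF b])
  qed
qed


section \<open>The heat semigroup\<close>

lemma
  fixes f :: "'n::finite \<Rightarrow> real \<Rightarrow> real"
  assumes f: "\<And>i. integrable lborel (f i)"
  shows integrable_prod_vec: "integrable lborel (\<lambda>z::real^'n. \<Prod>i\<in>UNIV. f i (z $ i))" (is ?A)
    and integral_prod_vec:
      "(LINT z|lborel. (\<Prod>i\<in>UNIV. f i ((z::real^'n) $ i))) = (\<Prod>i\<in>UNIV. LINT x|lborel. f i x)" (is ?B)
proof -
  let ?ax = "\<lambda>i::'n. axis i (1::real)"
  let ?T = "\<lambda>w. \<Sum>b\<in>Basis. w b *\<^sub>R (b::real^'n)"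
  let ?P = "\<Pi>\<^sub>M b\<in>(Basis::(real^'n) set). (lborel::real measure)"
  interpret product_sigma_finite "\<lambda>b::real^'n. lborel::real measure" ..
  have inj: "inj ?ax" by (auto simp: inj_def axis_eq_axis)
  have B: "Basis = range ?ax" by (auto simp: Basis_vec_def)
  have Ti: "(?T w) $ i = w (?ax i)" for w i
    unfolding B sum.reindex[OF inj] by (simp add: axis_def if_distrib sum.delta cong: if_cong)
  have [measurable]: "f i \<in> borel_measurable borel" for i
    using borel_measurable_integrable[OF f[of i]] by simp
  define g where "g b = f (inv ?ax b)" for b
  have g: "integrable lborel (g b)" for b by (simp add: g_def f)
  have eq: "(\<Prod>i\<in>UNIV. f i (?T w $ i)) = (\<Prod>b\<in>Basis. g b (w b))" for w
  proof -
    have "(\<Prod>b\<in>Basis. g b (w b)) = (\<Prod>i\<in>UNIV. f i (w (?ax i)))"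
      unfolding B prod.reindex[OF inj] by (simp add: g_def inv_f_f[OF inj])
    then show ?thesis by (simp only: Ti)
  qed
  have gg: "(\<Prod>b\<in>Basis. LINT x|lborel. g b x) = (\<Prod>i\<in>UNIV. LINT x|lborel. f i x)"
    unfolding B prod.reindex[OF inj] by (simp add: g_def inv_f_f[OF inj])
  show ?A
    by (subst lborel_eq, subst integrable_distr_eq) (auto simp only: eq intro!: product_integrable_prod g, measurable)
  show ?B
    apply (subst lborel_eq, subst integral_distr)
    apply measurable
    by (simp only: eq gg[symmetric]) (intro product_integral_prod g, auto)
qed

definition gauss :: "real^'n \<Rightarrow> real" where
  "gauss z = (\<Prod>i\<in>UNIV. std_normal_density (z $ i))"

lemma gauss_eq: "gauss (z::real^'n) = exp (- (norm z)\<^sup>2 / 2) / sqrt (2 * pi) ^ CARD('n)"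
  by (simp add: gauss_def std_normal_density_def prod.distrib prod_dividef exp_sum[symmetric] norm_vec_def L2_set_def
     sum_nonneg sum_negf[symmetric] sum_divide_distrib power_divide)

lemma gauss_measurable[measurable]: "gauss \<in> borel_measurable borel"
  unfolding gauss_eq[abs_def] by measurable

lemma gauss_nonneg: "gauss z \<ge> 0" by (simp add: gauss_def prod_nonneg)

lemma gauss_integrable: "integrable lborel (gauss :: real^'n \<Rightarrow> real)"
  and gauss_integral: "(LINT z|lborel. gauss (z::real^'n)) = 1"
  unfolding gauss_def[abs_def]
  by (auto intro!: integrable_prod_vec) (subst integral_prod_vec, auto)

lemma heat_kernel_scale:
  fixes z :: "real^'n"
  assumes "D > 0" "t > 0" defines "s \<equiv> sqrt (2 * D * t)"
  shows "heat_kernel D t (s *\<^sub>R z) = gauss z / s ^ CARD('n)"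
proof -
  have "sqrt (4 * pi * D * t) = sqrt (2 * pi) * s" 
    unfolding s_def by (subst real_sqrt_mult[symmetric]) (simp add: algebra_simps)
  moreover have "(norm (s *\<^sub>R z))\<^sup>2 / (4 * D * t) = (norm z)\<^sup>2 / 2"
    using assms by (simp add: power_mult_distrib)
  ultimately show ?thesis
    by (simp add: heat_kernel_def gauss_eq power_mult_distrib)
qed

lemma heat_integral:
  fixes W :: "(real^'n) \<Rightarrow>\<^sub>C 'b::euclidean_space"
  assumes "D > 0" "t > 0"
  shows "(LINT y|lborel. heat_kernel D t (x - y) *\<^sub>R W y) = 
     (LINT z|lborel. gauss z *\<^sub>R W (x + sqrt (2 * D * t) *\<^sub>R z))"
proof -
  define s where "s = sqrt (2 * D * t)"
  have s: "s > 0" using assms by (simp add: s_def)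
  have [measurable]: "apply_bcontfun W \<in> borel_measurable borel"
    by (intro borel_measurable_continuous_onI) simp
  have [measurable]: "heat_kernel D t \<in> borel_measurable borel"
    unfolding heat_kernel_def[abs_def] by measurable
  have *: "s ^ CARD('n) *\<^sub>R heat_kernel D t (- (s *\<^sub>R z)) *\<^sub>R W (x + s *\<^sub>R z) = gauss z *\<^sub>R W (x + s *\<^sub>R z)" for z
  proof -
    have "heat_kernel D t (- (s *\<^sub>R z)) = heat_kernel D t (s *\<^sub>R z)" by (simp add: heat_kernel_def)
    also have "\<dots> = gauss z / s ^ CARD('n)" using heat_kernel_scale[OF assms] by (simp add: s_def)
    finally show ?thesis using s by simp
  qed
  show ?thesis
    apply (subst lborel_affine[of s x])
    using s apply simp
    apply (subst integral_density)
    apply measurable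
    using s apply simp
    apply (subst integral_distr)
    apply measurable
    using s by (simp add: s_def[symmetric] *[symmetric])
qed

lemma bcontfun_measurable[measurable]:
  "apply_bcontfun (W :: 'a::topological_space \<Rightarrow>\<^sub>C 'b::{metric_space}) \<in> borel_measurable borel"
    by (intro borel_measurable_continuous_onI) simp

lemma gauss_W_integrable:
  fixes W :: "(real^'n) \<Rightarrow>\<^sub>C 'b::euclidean_space"
  shows "integrable lborel (\<lambda>z. gauss z *\<^sub>R W (x + s *\<^sub>R z))"
proof (rule Bochner_Integration.integrable_bound)
  show "integrable lborel (\<lambda>z::real^'n. gauss z * norm W)" by (intro integrable_mult_left gauss_integrable)
qed (auto intro!: AE_I2 mult_left_mono norm_bounded simp: gauss_nonneg, measurable)

lemma heat_apply:
  fixes W :: "(real^'n) \<Rightarrow>\<^sub>C 'b::euclidean_space"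
  assumes "D > 0" "t \<ge> 0"
  shows "heat_semigroup D t W x = (LINT z|lborel. gauss z *\<^sub>R W (x + sqrt (2 * D * t) *\<^sub>R z))"
proof (cases "t = 0")
  case True then show ?thesis by (simp add: heat_semigroup_def gauss_integral gauss_integrable)
next
  case False
  then have t: "t > 0" using assms by simp
  define s where "s = sqrt (2 * D * t)"
  let ?F = "\<lambda>x. (LINT z|lborel. gauss z *\<^sub>R W (x + s *\<^sub>R z))"
  have bd: "norm (?F x) \<le> norm W" for x
  proof -
    have "norm (?F x) \<le> (LINT z|lborel. gauss (z::real^'n) * norm W)"
      by (rule Bochner_Integration.integral_norm_bound_integral)
       (auto intro!: gauss_W_integrable integrable_mult_left gauss_integrable mult_left_mono norm_bounded simp: gauss_nonneg)
    then show ?thesis by (simp add: gauss_integral)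
  qed
  have "continuous_on UNIV ?F"
    unfolding continuous_on_sequentially
  proof (intro ballI allI impI, unfold o_def, elim conjE)
    fix u :: "nat \<Rightarrow> real^'n" and a assume u: "u \<longlonglongrightarrow> a"
    show "(\<lambda>n. ?F (u n)) \<longlonglongrightarrow> ?F a"
    proof (rule integral_dominated_convergence[where w="\<lambda>z. gauss z * norm W"])
      show "AE z in lborel. (\<lambda>n. gauss z *\<^sub>R W (u n + s *\<^sub>R z)) \<longlonglongrightarrow> gauss z *\<^sub>R W (a + s *\<^sub>R z)"
        by (intro AE_I2 tendsto_intros continuous_on_tendsto_compose[of UNIV "apply_bcontfun W"] u) auto
    qed (auto intro!: integrable_mult_left gauss_integrable mult_left_mono norm_bounded AE_I2 simp: gauss_nonneg, measurable)
  qed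
  then have "?F \<in> bcontfun" using bd by (rule bcontfun_normI)
  then show ?thesis using t by (simp add: heat_semigroup_def heat_integral[OF assms(1)] Bcontfun_inverse s_def)
qed

lemma heat_semigroup_norm: 
  fixes W :: "(real^'n) \<Rightarrow>\<^sub>C 'b::euclidean_space"
  assumes "D > 0" "t \<ge> 0" shows "norm (heat_semigroup D t W) \<le> norm W"
proof (rule norm_bound)
  fix x
  have "norm (heat_semigroup D t W x) \<le> (LINT z|lborel. gauss (z::real^'n) * norm W)"
    unfolding heat_apply[OF assms] by (rule Bochner_Integration.integral_norm_bound_integral)
       (auto intro!: gauss_W_integrable integrable_mult_left gauss_integrable mult_left_mono norm_bounded simp: gauss_nonneg)
  then show "norm (heat_semigroup D t W x) \<le> norm W" by (simp add: gauss_integral)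
qed

lemma
  fixes a :: "'n::finite \<Rightarrow> nat"
  shows gauss_monomial_integrable: "integrable lborel (\<lambda>z::real^'n. gauss z * (\<Prod>i\<in>UNIV. (z $ i) ^ a i))"
    and gauss_monomial_integral: "(LINT z|lborel. gauss z * (\<Prod>i\<in>UNIV. ((z::real^'n) $ i) ^ a i))
     = (\<Prod>i\<in>UNIV. LINT x|lborel. std_normal_density x * x ^ a i)"
  unfolding gauss_def prod.distrib[symmetric]
  by (auto intro!: integrable_prod_vec integrable_std_normal_moment)
     (subst integral_prod_vec, auto intro!: integrable_std_normal_moment)

lemma prod_pow_delta:
  "(\<Prod>k\<in>UNIV. (z $ k) ^ ((if k = i then p else 0) + (if k = j then q else 0))) = (z $ i) ^ p * ((z::real^'n) $ j) ^ q"
  by (simp add: power_add prod.distrib if_distrib[of "\<lambda>e. _ ^ e"] cong: if_cong)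

lemma gauss_pow2_integrable: "integrable lborel (\<lambda>z::real^'n. gauss z * ((z $ i)^p * (z $ j)^q))"
  using gauss_monomial_integrable[of "\<lambda>k. (if k = i then p else 0) + (if k = j then q else 0)"]
  by (simp only: prod_pow_delta)

lemma gauss_first_moment: "(LINT z|lborel. gauss z * ((z::real^'n) $ i)) = 0"
proof -
  have "(LINT z|lborel. gauss z * ((z::real^'n) $ i)) = 
     (\<Prod>k\<in>UNIV. LINT x|lborel. std_normal_density x * x ^ ((if k = i then 1 else 0) + (if k = i then 0 else 0)))"
    unfolding gauss_monomial_integral[symmetric] prod_pow_delta by simp
  also have "\<dots> = 0"
    using integral_std_normal_moment_odd[of 0] by (intro prod_zero) (auto intro!: exI[of _ i])
  finally show ?thesis .
qed

lemma gauss_second_moment: "(LINT z|lborel. gauss z * ((z::real^'n) $ i * z $ j)) = (if i = j then 1 else 0)"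
proof -
  have "(LINT z|lborel. gauss z * ((z::real^'n) $ i * z $ j)) = 
     (\<Prod>k\<in>UNIV. LINT x|lborel. std_normal_density x * x ^ ((if k = i then 1 else 0) + (if k = j then 1 else 0)))"
    unfolding gauss_monomial_integral[symmetric] prod_pow_delta by simp
  also have "\<dots> = (if i = j then 1 else 0)"
  proof (cases "i = j")
    case True
    have "(LINT x|lborel. std_normal_density x * x ^ ((if k = i then 1 else 0) + (if k = j then 1 else 0))) = 1" for k
      using True integral_std_normal_moment_even[of 1] integral_std_normal_moment_even[of 0] 
      by (auto simp: power2_eq_square)
    then show ?thesis using True by simp
  next
    case False
    then show ?thesis
      using integral_std_normal_moment_odd[of 0] by (subst prod_zero) (auto intro!: exI[of _ i])
  qed
  finally show ?thesis .
qed

lemma gauss_norm2_integrable: "integrable lborel (\<lambda>z::real^'n. gauss z * (norm z)\<^sup>2)"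
proof -
  have "(\<lambda>z::real^'n. gauss z * (norm z)\<^sup>2) = (\<lambda>z. \<Sum>i\<in>UNIV. gauss z * ((z $ i)^2 * (z $ i)^0))"
    by (simp add: norm_vec_def L2_set_def sum_nonneg sum_distrib_left)
  then show ?thesis by (simp only:) (intro Bochner_Integration.integrable_sum gauss_pow2_integrable)
qed

lemma gauss_norm4_integrable: "integrable lborel (\<lambda>z::real^'n. gauss z * (norm z)^4)"
proof -
  have *: "norm z ^ 4 = (norm z)\<^sup>2 * (norm z)\<^sup>2" for z :: "real^'n" by (simp add: eval_nat_numeral)
  have "(\<lambda>z::real^'n. gauss z * (norm z)^4) = (\<lambda>z. \<Sum>i\<in>UNIV. \<Sum>j\<in>UNIV. gauss z * ((z $ i)^2 * (z $ j)^2))"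
  proof
    fix z :: "real^'n"
    have "(norm z)\<^sup>2 = (\<Sum>i\<in>UNIV. (z $ i)\<^sup>2)" by (simp add: norm_vec_def L2_set_def sum_nonneg)
    then show "gauss z * (norm z)^4 = (\<Sum>i\<in>UNIV. \<Sum>j\<in>UNIV. gauss z * ((z $ i)^2 * (z $ j)^2))"
      unfolding * by (simp only: sum_product) (simp only: sum_distrib_left)
  qed
  then show ?thesis by (simp only:) (intro Bochner_Integration.integrable_sum gauss_pow2_integrable)
qed

lemma heat_semigroup_periodic:
  fixes W :: "(real^'n) \<Rightarrow>\<^sub>C 'b::euclidean_space"
  assumes "D > 0" "t \<ge> 0" "W \<in> periodic_space"
  shows "heat_semigroup D t W \<in> periodic_space"
proof -
  have "W (x + axis i 1 + s *\<^sub>R z) = W (x + s *\<^sub>R z)" for x i s z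
    using assms(3) by (simp add: periodic_space_def add.assoc add.commute[of "axis i 1"]) (simp add: add.assoc[symmetric])
  then show ?thesis by (simp add: periodic_space_def heat_apply[OF assms(1,2)])
qed

lemma heat_semigroup_linear:
  fixes V W :: "(real^'n) \<Rightarrow>\<^sub>C 'b::euclidean_space"
  assumes "D > 0" "t \<ge> 0"
  shows "heat_semigroup D t (a *\<^sub>R V + b *\<^sub>R W) = a *\<^sub>R heat_semigroup D t V + b *\<^sub>R heat_semigroup D t W"
proof (rule bcontfun_eqI)
  fix x
  show "heat_semigroup D t (a *\<^sub>R V + b *\<^sub>R W) x = (a *\<^sub>R heat_semigroup D t V + b *\<^sub>R heat_semigroup D t W) x"
    using gauss_W_integrable[of V x "sqrt (2 * D * t)"] gauss_W_integrable[of W x "sqrt (2 * D * t)"]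
    by (simp add: heat_apply[OF assms] scaleR_right_distrib scaleR_left_commute[of "gauss _"]
        del: scaleR_scaleR)
qed

lemma heat_semigroup_continuous:
  fixes W :: "(real^'n) \<Rightarrow>\<^sub>C 'b::euclidean_space"
  assumes D: "D > 0" and W: "W \<in> periodic_space"
  shows "continuous_on {0..} (\<lambda>t. heat_semigroup D t W)"
  unfolding continuous_on_def
proof (intro ballI tendstoI)
  fix t e :: real assume t: "t \<in> {0..}" and e: "e > 0"
  obtain C where C: "C \<ge> 0" "\<And>x v. norm (W (x + v) - W x) \<le> e / 2 + C * (norm v)\<^sup>2"
    using periodic_modulus[OF W, of "e / 2"] e by auto
  let ?s = "\<lambda>t. sqrt (2 * D * t)"
  define M where "M = (LINT z|lborel. gauss (z::real^'n) * (norm z)\<^sup>2)"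
  have est: "dist (heat_semigroup D r W) (heat_semigroup D t W) \<le> e / 2 + C * (?s r - ?s t)\<^sup>2 * M" if r: "r \<ge> 0" for r
  proof (rule dist_bound)
    fix x
    have int: "integrable lborel (\<lambda>z::real^'n. gauss z * (e / 2) + gauss z * (norm z)\<^sup>2 * (C * (?s r - ?s t)\<^sup>2))"
      by (intro Bochner_Integration.integrable_add integrable_mult_left gauss_integrable gauss_norm2_integrable)
    have "dist (heat_semigroup D r W x) (heat_semigroup D t W x) 
      = norm (LINT z|lborel. gauss z *\<^sub>R W (x + ?s r *\<^sub>R z) - gauss z *\<^sub>R W (x + ?s t *\<^sub>R z))"
      using t r D by (simp add: heat_apply dist_norm gauss_W_integrable)
    also have "\<dots> \<le> (LINT z|lborel. gauss (z::real^'n) * (e / 2) + gauss z * (norm z)\<^sup>2 * (C * (?s r - ?s t)\<^sup>2))"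
    proof (rule Bochner_Integration.integral_norm_bound_integral)
      fix z :: "real^'n"
      have "norm (W (x + ?s r *\<^sub>R z) - W (x + ?s t *\<^sub>R z)) \<le> e / 2 + C * (norm ((?s r - ?s t) *\<^sub>R z))\<^sup>2"
        using C(2)[of "x + ?s t *\<^sub>R z" "(?s r - ?s t) *\<^sub>R z"] by (simp add: algebra_simps)
      also have "\<dots> = e / 2 + (norm z)\<^sup>2 * (C * (?s r - ?s t)\<^sup>2)"
        by (simp add: power_mult_distrib)
      finally show "norm (gauss z *\<^sub>R W (x + ?s r *\<^sub>R z) - gauss z *\<^sub>R W (x + ?s t *\<^sub>R z))
          \<le> gauss z * (e / 2) + gauss z * (norm z)\<^sup>2 * (C * (?s r - ?s t)\<^sup>2)"
        by (simp only: scaleR_diff_right[symmetric] norm_scaleR abs_of_nonneg[OF gauss_nonneg] mult.assoc distrib_left[symmetric])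
          (rule mult_left_mono[OF _ gauss_nonneg])
    qed (intro gauss_W_integrable Bochner_Integration.integrable_diff int)+
    also have "\<dots> = e / 2 + C * (?s r - ?s t)\<^sup>2 * M"
      by (subst Bochner_Integration.integral_add)
        (auto simp: gauss_integral M_def intro!: integrable_mult_left gauss_integrable gauss_norm2_integrable)
    finally show "dist (heat_semigroup D r W x) (heat_semigroup D t W x) \<le> e / 2 + C * (?s r - ?s t)\<^sup>2 * M" .
  qed
  have "((\<lambda>r. e / 2 + C * (?s r - ?s t)\<^sup>2 * M) \<longlongrightarrow> e / 2 + C * (?s t - ?s t)\<^sup>2 * M) (at t within {0..})"
    by (intro tendsto_intros)
  from order_tendstoD(2)[OF this, of e] have "eventually (\<lambda>r. e / 2 + C * (?s r - ?s t)\<^sup>2 * M < e) (at t within {0..})"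
    using e by simp
  moreover have "eventually (\<lambda>r. r \<in> {0..}) (at t within {0..})"
    by (simp add: eventually_at_filter)
  ultimately show "eventually (\<lambda>r. dist (heat_semigroup D r W) (heat_semigroup D t W) < e) (at t within {0..})"
    by eventually_elim (use est in fastforce)
qed

lemma sum_bcontfun_apply:
  "apply_bcontfun (\<Sum>i\<in>S. F i) x = (\<Sum>i\<in>S. apply_bcontfun (F i :: 'a::topological_space \<Rightarrow>\<^sub>C 'b::real_normed_vector) x)"
  by (induction S rule: infinite_finite_induct) auto

lemma heat_kernel_1:
  fixes c :: "real^'n"
  assumes "D > 0" "t > 0"
  shows "(LINT y|lborel. heat_kernel D t (y - c)) = 1"
    and "integrable lborel (\<lambda>y. heat_kernel D t (y - c))"
proof -
  have "(LINT y|lborel. heat_kernel D t (c - y) *\<^sub>R (const_bcontfun 1 :: (real^'n) \<Rightarrow>\<^sub>C real) y) = 1"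
    unfolding heat_integral[OF assms] by (simp add: gauss_integral)
  moreover have "heat_kernel D t (c - y) = heat_kernel D t (y - c)" for y
    by (simp add: heat_kernel_def norm_minus_commute)
  ultimately show *: "(LINT y|lborel. heat_kernel D t (y - c)) = 1"
    by simp
  show "integrable lborel (\<lambda>y. heat_kernel D t (y - c))"
    by (rule ccontr) (use * not_integrable_integral_eq[of lborel "\<lambda>y. heat_kernel D t (y - c)"] in linarith)
qed

lemma heat_kernel_mult:
  fixes x y z :: "real^'n"
  assumes "D > 0" "t > 0" "r > 0"
  shows "heat_kernel D t (x - y) * heat_kernel D r (y - z) =
     heat_kernel D (t + r) (x - z) * heat_kernel D (t * r / (t + r)) (y - ((r / (t + r)) *\<^sub>R x + (t / (t + r)) *\<^sub>R z))"
proof -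
  define u v where "u = x - z" and "v = y - z"
  define p where "p = r / (t + r)"
  have p: "t / (t + r) = 1 - p" "t * r / (t + r) = t * p" using assms by (auto simp: p_def field_simps)
  have p0: "p > 0" "p < 1" using assms by (auto simp: p_def field_simps)
  have "r * (1 - p) = t * p" using assms by (simp add: p(1)[symmetric]) (simp add: p_def)
  then have p3: "r = t * p / (1 - p)" using p0 by (simp add: field_simps)
  have y: "y - ((r / (t + r)) *\<^sub>R x + (t / (t + r)) *\<^sub>R z) = v - p *\<^sub>R u"
    unfolding p(1) u_def v_def p_def[symmetric] by (simp add: algebra_simps)
  have xy: "x - y = u - v" by (simp add: u_def v_def)
  define U V P where "U = u \<bullet> u" and "V = v \<bullet> v" and "P = u \<bullet> v"
  have n1: "(norm (u - v))\<^sup>2 = U - 2 * P + V"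
    by (simp add: power2_norm_eq_inner U_def V_def P_def algebra_simps inner_commute)
  have n2: "(norm (v - p *\<^sub>R u))\<^sup>2 = V - 2 * p * P + p\<^sup>2 * U"
    unfolding power2_norm_eq_inner U_def V_def P_def
    by (simp add: inner_diff_left inner_diff_right inner_commute) (simp add: power2_eq_square algebra_simps)
  have n3: "(norm u)\<^sup>2 = U" "(norm v)\<^sup>2 = V" by (simp_all add: power2_norm_eq_inner U_def V_def)
  have tr: "t + r = t / (1 - p)" unfolding p3 using p0 by (simp add: field_simps)
  have e: "- (norm (u - v))\<^sup>2 / (4 * D * t) + - (norm v)\<^sup>2 / (4 * D * r) =
        - (norm u)\<^sup>2 / (4 * D * (t + r)) + - (norm (v - p *\<^sub>R u))\<^sup>2 / (4 * D * (t * r / (t + r)))"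
  proof -
    have "(U - 2 * P + V) / t + V / r = U / (t + r) + (V - 2 * p * P + p\<^sup>2 * U) / (t * r / (t + r))"
      unfolding p(2) tr p3 using p0 assms by (simp add: field_simps power2_eq_square)
    then have "((U - 2 * P + V) / t + V / r) / (4 * D) = (U / (t + r) + (V - 2 * p * P + p\<^sup>2 * U) / (t * r / (t + r))) / (4 * D)"
      by simp
    then have "(U - 2 * P + V) / (4 * D * t) + V / (4 * D * r) = U / (4 * D * (t + r)) + (V - 2 * p * P + p\<^sup>2 * U) / (4 * D * (t * r / (t + r)))"
      by (simp only: add_divide_distrib divide_divide_eq_left mult.commute mult.left_commute)
    then show ?thesis unfolding n1 n2 n3 by linarith
  qed
  have s: "sqrt (4 * pi * D * t) * sqrt (4 * pi * D * r) = sqrt (4 * pi * D * (t + r)) * sqrt (4 * pi * D * (t * r / (t + r)))"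
    using assms by (simp add: real_sqrt_mult[symmetric] field_simps)
  show ?thesis
    unfolding y xy unfolding u_def[symmetric] v_def[symmetric] heat_kernel_def
    by (simp only: times_divide_times_eq exp_add[symmetric] power_mult_distrib[symmetric] e s)
qed

lemma heat_semigroup_law:
  fixes W :: "(real^'n) \<Rightarrow>\<^sub>C 'b::euclidean_space"
  assumes D: "D > 0" and "t \<ge> 0" "r \<ge> 0"
  shows "heat_semigroup D t (heat_semigroup D r W) = heat_semigroup D (t + r) W"
proof (cases "t = 0 \<or> r = 0")
  case True then show ?thesis by (auto simp: heat_semigroup_def)
next
  case False
  then have t: "t > 0" "r > 0" "t + r > 0" "t * r / (t + r) > 0" using assms by auto
  have [measurable]: "heat_kernel D s \<in> borel_measurable borel" for s
    unfolding heat_kernel_def[abs_def] by measurable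
  have nn: "heat_kernel D s z \<ge> 0" if "s > 0" for s and z :: "real^'n" using that D by (simp add: heat_kernel_def)
  have ker: "heat_semigroup D s V x = (LINT y|lborel. heat_kernel D s (x - y) *\<^sub>R V y)" if "s > 0" for s x and V :: "(real^'n) \<Rightarrow>\<^sub>C 'b"
    unfolding heat_integral[OF D that] using heat_apply[OF D, of s V x] that by simp
  show ?thesis
  proof (rule bcontfun_eqI)
    fix x :: "real^'n"
    let ?c = "\<lambda>z. (r / (t + r)) *\<^sub>R x + (t / (t + r)) *\<^sub>R z"
    let ?f = "\<lambda>(z, y). (heat_kernel D t (x - y) * heat_kernel D r (y - z)) *\<^sub>R W z"
    have feq: "?f (z, y) = (heat_kernel D (t + r) (x - z) * heat_kernel D (t * r / (t + r)) (y - ?c z)) *\<^sub>R W z" for y z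
      by (simp add: heat_kernel_mult[OF D t(1,2)])
    have k1: "integrable lborel (\<lambda>z. heat_kernel D (t + r) (x - z))"
      using heat_kernel_1(2)[OF D t(3), of x] by (simp add: heat_kernel_def norm_minus_commute)
    have int: "integrable (lborel \<Otimes>\<^sub>M lborel) ?f"
    proof (rule lborel_pair.Fubini_integrable)
      show "?f \<in> borel_measurable (lborel \<Otimes>\<^sub>M lborel)" by measurable
      show "AE z in lborel. integrable lborel (\<lambda>y. ?f (z, y))"
        unfolding feq by (intro AE_I2 integrable_scaleR_left integrable_mult_right heat_kernel_1(2) D t)
      have "(LINT y|lborel. norm (?f (z, y))) = heat_kernel D (t + r) (x - z) * norm (W z)" for z
        unfolding feq using heat_kernel_1(1)[OF D t(4), of "?c z"] by (simp add: abs_mult nn t del: divide_pos_pos)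
      then show "integrable lborel (\<lambda>z. LINT y|lborel. norm (?f (z, y)))"
        by (simp only:) (rule Bochner_Integration.integrable_bound[OF integrable_mult_left[OF k1, of "norm W"]],
          measurable, auto intro!: AE_I2 mult_mono norm_bounded simp: abs_mult nn t)
    qed
    have "heat_semigroup D t (heat_semigroup D r W) x = (LINT y|lborel. LINT z|lborel. ?f (z, y))"
      by (simp add: ker t Bochner_Integration.integral_scaleR_right[symmetric] scaleR_scaleR[symmetric]
           del: scaleR_scaleR Bochner_Integration.integral_scaleR_right)
    also have "\<dots> = (LINT z|lborel. LINT y|lborel. ?f (z, y))"
      using int by (intro lborel_pair.Fubini_integral) simp
    also have "\<dots> = heat_semigroup D (t + r) W x"
      unfolding feq ker[OF t(3)] 
      by (simp only: Bochner_Integration.integral_scaleR_left[OF integrable_mult_right[OF heat_kernel_1(2)[OF D t(4)]]]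
          integral_mult_right_zero heat_kernel_1(1)[OF D t(4)] mult_1_right)
    finally show "heat_semigroup D t (heat_semigroup D r W) x = heat_semigroup D (t + r) W x" .
  qed
qed

lemma taylor_estimate:
  fixes W :: "real^'n \<Rightarrow> 'b::euclidean_space" and v :: "real^'n"
    and G :: "'n \<Rightarrow> real^'n \<Rightarrow> 'b" and H :: "'n \<Rightarrow> 'n \<Rightarrow> real^'n \<Rightarrow> 'b"
  assumes dW: "\<And>x. (W has_derivative (\<lambda>v. \<Sum>i\<in>UNIV. v $ i *\<^sub>R G i x)) (at x)"
    and dG: "\<And>i x. (G i has_derivative (\<lambda>v. \<Sum>j\<in>UNIV. v $ j *\<^sub>R H i j x)) (at x)"
    and H: "\<And>i j w. norm w \<le> norm v \<Longrightarrow> norm (H i j (x + w) - H i j x) \<le> B"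
  shows "norm (W (x + v) - W x - (\<Sum>i\<in>UNIV. v $ i *\<^sub>R G i x)
      - (\<Sum>i\<in>UNIV. \<Sum>j\<in>UNIV. (v $ i * v $ j / 2) *\<^sub>R H i j x)) \<le> (real CARD('n) * norm v)\<^sup>2 * B"
proof -
  let ?m = "real CARD('n)"
  have B: "B \<ge> 0" using H[where w=0] norm_ge_zero order_trans by (metis norm_zero)
  have line: "((\<lambda>r. x + r *\<^sub>R v) has_derivative (\<lambda>h. h *\<^sub>R v)) (at r within S)" for r S
    by (auto intro!: derivative_eq_intros)
  have WL: "((\<lambda>r. W (x + r *\<^sub>R v)) has_derivative (\<lambda>h. \<Sum>i\<in>UNIV. (h *\<^sub>R v) $ i *\<^sub>R G i (x + r *\<^sub>R v))) (at r within S)" for r S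
    using has_derivative_compose[OF line[of r S] dW] by simp
  have GL: "((\<lambda>r. G i (x + r *\<^sub>R v)) has_derivative (\<lambda>h. \<Sum>j\<in>UNIV. (h *\<^sub>R v) $ j *\<^sub>R H i j (x + r *\<^sub>R v))) (at r within S)" for i r S
    using has_derivative_compose[OF line[of r S] dG] by simp
  define g where "g i r = G i (x + r *\<^sub>R v) - r *\<^sub>R (\<Sum>j\<in>UNIV. v $ j *\<^sub>R H i j x)" for i r
  have vi: "\<bar>v $ i\<bar> \<le> norm v" for i by (rule component_le_norm_cart)
  have g: "norm (g i r - g i 0) \<le> ?m * norm v * B" if r: "r \<in> {0..1}" for i r
  proof -
    have "norm (g i r - g i 0) \<le> (?m * norm v * B) * norm (r - 0)"
    proof (rule differentiable_bound[where S="{0..1}"])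
      fix s :: real assume s: "s \<in> {0..1}"
      let ?d = "\<lambda>h. h *\<^sub>R (\<Sum>j\<in>UNIV. v $ j *\<^sub>R (H i j (x + s *\<^sub>R v) - H i j x))"
      show "(g i has_derivative ?d) (at s within {0..1})"
        unfolding g_def
        by (rule derivative_eq_intros GL refl)+
          (auto simp: fun_eq_iff scaleR_diff_right sum_subtractf scaleR_sum_right)
      have "norm (H i j (x + s *\<^sub>R v) - H i j x) \<le> B" for j
        using s by (intro H) (auto intro: mult_left_le_one_le)
      then have "norm (\<Sum>j\<in>UNIV. v $ j *\<^sub>R (H i j (x + s *\<^sub>R v) - H i j x)) \<le> ?m * (norm v * B)"
        by (intro sum_norm_bound[of UNIV _ "norm v * B", simplified]) (simp add: mult_mono vi B)
      then show "onorm ?d \<le> ?m * norm v * B"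
        by (intro onorm_le) (simp add: mult.commute[of _ "\<bar>_\<bar>"] mult_left_mono mult.assoc)
    qed (use r in auto)
    also have "\<dots> \<le> ?m * norm v * B" using r B by (intro mult_left_le) auto
    finally show ?thesis .
  qed
  define f where "f r = W (x + r *\<^sub>R v) - r *\<^sub>R (\<Sum>i\<in>UNIV. v $ i *\<^sub>R G i x)
      - r\<^sup>2 *\<^sub>R (\<Sum>i\<in>UNIV. \<Sum>j\<in>UNIV. (v $ i * v $ j / 2) *\<^sub>R H i j x)" for r
  have "norm (f 1 - f 0) \<le> (?m * norm v * (?m * norm v * B)) * norm (1 - 0 :: real)"
  proof (rule differentiable_bound[where S="{0..1}"])
    fix s :: real assume s: "s \<in> {0..1}"
    let ?d = "\<lambda>h. h *\<^sub>R (\<Sum>i\<in>UNIV. v $ i *\<^sub>R (g i s - g i 0))"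
    have *: "(\<Sum>i\<in>UNIV. (h *\<^sub>R v) $ i *\<^sub>R G i (x + s *\<^sub>R v)) - h *\<^sub>R (\<Sum>i\<in>UNIV. v $ i *\<^sub>R G i x)
       - (2 * s * h) *\<^sub>R (\<Sum>i\<in>UNIV. \<Sum>j\<in>UNIV. (v $ i * v $ j / 2) *\<^sub>R H i j x) = ?d h" for h
      by (simp add: g_def scaleR_sum_right sum_subtractf[symmetric] scaleR_diff_right algebra_simps)
    show "(f has_derivative ?d) (at s within {0..1})"
      unfolding f_def
      by (rule derivative_eq_intros WL refl)+ (auto simp: fun_eq_iff *[symmetric] mult_ac)
    have "norm (\<Sum>i\<in>UNIV. v $ i *\<^sub>R (g i s - g i 0)) \<le> ?m * (norm v * (?m * norm v * B))"
      using g[OF s] by (intro sum_norm_bound[of UNIV _ "norm v * (?m * norm v * B)", simplified]) (simp add: mult_mono vi B)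
    then show "onorm ?d \<le> ?m * norm v * (?m * norm v * B)"
      by (intro onorm_le) (simp add: mult.commute[of _ "\<bar>_\<bar>"] mult_left_mono mult.assoc)
  qed auto
  then show ?thesis by (simp add: f_def power2_eq_square algebra_simps)
qed

lemma heat_semigroup_generator:
  fixes W :: "(real^'n) \<Rightarrow>\<^sub>C 'b::euclidean_space"
    and G :: "'n \<Rightarrow> (real^'n) \<Rightarrow>\<^sub>C 'b" and H :: "'n \<Rightarrow> 'n \<Rightarrow> (real^'n) \<Rightarrow>\<^sub>C 'b"
  assumes D: "D > 0"
    and H: "\<And>i j. H i j \<in> periodic_space"
    and dW: "\<And>x. (W has_derivative (\<lambda>v. \<Sum>i\<in>UNIV. v $ i *\<^sub>R G i x)) (at x)"
    and dG: "\<And>i x. (G i has_derivative (\<lambda>v. \<Sum>j\<in>UNIV. v $ j *\<^sub>R H i j x)) (at x)"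
  shows "((\<lambda>h. (heat_semigroup D h W - W) /\<^sub>R h) \<longlongrightarrow> D *\<^sub>R (\<Sum>i\<in>UNIV. H i i)) (at_right 0)"
proof (rule tendstoI)
  fix \<epsilon> :: real assume e: "\<epsilon> > 0"
  let ?m = "real CARD('n)"
  define M2 M4 where "M2 = (LINT z|lborel. gauss (z::real^'n) * (norm z)\<^sup>2)"
    and "M4 = (LINT z|lborel. gauss (z::real^'n) * (norm z)^4)"
  define e where "e = \<epsilon> / ((2 * D * ?m\<^sup>2) * (2 * (M2 + 1)))"
  have M2: "M2 \<ge> 0" unfolding M2_def by (intro integral_nonneg_AE AE_I2 mult_nonneg_nonneg gauss_nonneg) auto
  have e0: "e > 0" using e D M2 by (simp add: e_def)
  have e2: "2 * D * ?m\<^sup>2 * e * M2 < \<epsilon>"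
  proof -
    have "2 * D * ?m\<^sup>2 * e * M2 = (2 * D * ?m\<^sup>2) * (M2 * \<epsilon>) / ((2 * D * ?m\<^sup>2) * (2 * (M2 + 1)))"
      unfolding e_def by (simp only: times_divide_eq_right times_divide_eq_left mult_ac)
    also have "\<dots> = \<epsilon> * (M2 / (2 * (M2 + 1)))"
      using D by (subst mult_divide_mult_cancel_left) (simp_all only: times_divide_eq_right mult.commute, simp)
    also have "\<dots> < \<epsilon> * 1" using e M2 by (intro mult_strict_left_mono) (auto simp: field_simps)
    finally show ?thesis by simp
  qed
  have "\<exists>C\<ge>0. \<forall>x v. norm (H i j (x + v) - H i j x) \<le> e + C * (norm v)\<^sup>2" for i j
    by (rule periodic_modulus[OF H e0])
  then obtain c where c: "\<And>i j. c i j \<ge> 0" "\<And>i j x v. norm (H i j (x + v) - H i j x) \<le> e + c i j * (norm v)\<^sup>2"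
    by metis
  define C where "C = (\<Sum>i\<in>UNIV. \<Sum>j\<in>UNIV. c i j)"
  have cC: "c i j \<le> C" for i j
  proof -
    have "c i j \<le> (\<Sum>j\<in>UNIV. c i j)" by (intro member_le_sum) (auto simp: c)
    also have "\<dots> \<le> C" unfolding C_def by (intro member_le_sum[of i UNIV "\<lambda>i. \<Sum>j\<in>UNIV. c i j"]) (auto simp: c sum_nonneg)
    finally show ?thesis .
  qed
  then have C: "C \<ge> 0" using c(1) order_trans by blast
  have modH: "norm (H i j (x + w) - H i j x) \<le> e + C * (norm v)\<^sup>2" if "norm w \<le> norm v" for i j x w v
  proof -
    have "norm (H i j (x + w) - H i j x) \<le> e + c i j * (norm w)\<^sup>2" by (rule c)
    also have "\<dots> \<le> e + C * (norm v)\<^sup>2" using that c C cC by (intro add_left_mono mult_mono power_mono) auto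
    finally show ?thesis .
  qed
  let ?L = "\<Sum>i\<in>UNIV. H i i"
  have est: "dist ((heat_semigroup D h W - W) /\<^sub>R h) (D *\<^sub>R ?L) \<le> 2 * D * ?m\<^sup>2 * e * M2 + h * (4 * D\<^sup>2 * ?m\<^sup>2 * C * M4)" if h: "h > 0" for h
  proof (rule dist_bound)
    fix x
    define s where "s = sqrt (2 * D * h)"
    have s: "s > 0" "s\<^sup>2 = 2 * D * h" using D h by (auto simp: s_def)
    define R where "R v = W (x + v) - W x - (\<Sum>i\<in>UNIV. v $ i *\<^sub>R G i x)
      - (\<Sum>i\<in>UNIV. \<Sum>j\<in>UNIV. (v $ i * v $ j / 2) *\<^sub>R H i j x)" for v
    have R: "norm (R v) \<le> (?m * norm v)\<^sup>2 * (e + C * (norm v)\<^sup>2)" for v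
      unfolding R_def
      by (rule taylor_estimate[where W="apply_bcontfun W" and G="\<lambda>i. apply_bcontfun (G i)"
            and H="\<lambda>i j. apply_bcontfun (H i j)"]) (fact dW dG modH)+
    have i1: "integrable lborel (\<lambda>z::real^'n. gauss z * z $ i)" for i
      using gauss_pow2_integrable[of i 1 i 0] by simp
    have i2: "integrable lborel (\<lambda>z::real^'n. gauss z * (z $ i * z $ j))" for i j
      using gauss_pow2_integrable[of i 1 j 1] by simp
    have Req: "gauss z *\<^sub>R R (s *\<^sub>R z) = gauss z *\<^sub>R W (x + s *\<^sub>R z) - gauss z *\<^sub>R W x
        - (\<Sum>i\<in>UNIV. (gauss z * z $ i) *\<^sub>R (s *\<^sub>R G i x))
        - (\<Sum>i\<in>UNIV. \<Sum>j\<in>UNIV. (gauss z * (z $ i * z $ j)) *\<^sub>R ((s\<^sup>2 / 2) *\<^sub>R H i j x))" for z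
      by (simp add: R_def scaleR_diff_right scaleR_sum_right power2_eq_square mult_ac)
    note ints = Bochner_Integration.integrable_diff Bochner_Integration.integrable_sum integrable_scaleR_left
        gauss_W_integrable gauss_integrable i1 i2
    have intR: "integrable lborel (\<lambda>z. gauss z *\<^sub>R R (s *\<^sub>R z))"
      unfolding Req by (intro ints)
    have "(LINT z|lborel. gauss z *\<^sub>R R (s *\<^sub>R z)) = heat_semigroup D h W x - W x
        - (\<Sum>i\<in>UNIV. (LINT z|lborel. gauss (z::real^'n) * z $ i) *\<^sub>R (s *\<^sub>R G i x))
        - (\<Sum>i\<in>UNIV. \<Sum>j\<in>UNIV. (LINT z|lborel. gauss (z::real^'n) * (z $ i * z $ j)) *\<^sub>R ((s\<^sup>2 / 2) *\<^sub>R H i j x))"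
      unfolding Req
      apply (subst Bochner_Integration.integral_diff, (intro ints)+)
      apply (subst Bochner_Integration.integral_diff, (intro ints)+)
      apply (subst Bochner_Integration.integral_diff, (intro ints)+)
      apply (subst Bochner_Integration.integral_sum, (intro ints)+)
      apply (subst Bochner_Integration.integral_sum, (intro ints)+)
      apply (subst Bochner_Integration.integral_sum, (intro ints)+)
      using D h by (simp add: heat_apply s_def gauss_integral i1 i2 gauss_integrable)
    also have "\<dots> = heat_semigroup D h W x - W x - h *\<^sub>R (D *\<^sub>R ?L) x"
    proof -
      have "(\<Sum>j\<in>UNIV. (LINT z|lborel. gauss (z::real^'n) * (z $ i * z $ j)) *\<^sub>R ((s\<^sup>2 / 2) *\<^sub>R H i j x)) = (h * D) *\<^sub>R H i i x" for i
      proof -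
        have "(\<Sum>j\<in>UNIV. (LINT z|lborel. gauss (z::real^'n) * (z $ i * z $ j)) *\<^sub>R ((s\<^sup>2 / 2) *\<^sub>R H i j x))
            = (\<Sum>j\<in>UNIV. if i = j then (h * D) *\<^sub>R H i j x else 0)"
          by (intro sum.cong refl) (simp add: gauss_second_moment s mult.commute)
        then show ?thesis by simp
      qed
      then show ?thesis
        by (simp add: gauss_first_moment sum_bcontfun_apply scaleR_sum_right)
    qed
    finally have eq: "heat_semigroup D h W x - W x - h *\<^sub>R (D *\<^sub>R ?L) x = (LINT z|lborel. gauss z *\<^sub>R R (s *\<^sub>R z))" by simp
    have "norm (LINT z|lborel. gauss z *\<^sub>R R (s *\<^sub>R z)) \<le>
       (LINT z|lborel. gauss (z::real^'n) * (norm z)\<^sup>2 * (?m\<^sup>2 * s\<^sup>2 * e) + gauss z * (norm z)^4 * (?m\<^sup>2 * s^4 * C))"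
    proof (rule Bochner_Integration.integral_norm_bound_integral[OF intR])
      show "integrable lborel (\<lambda>z::real^'n. gauss z * (norm z)\<^sup>2 * (?m\<^sup>2 * s\<^sup>2 * e) + gauss z * (norm z)^4 * (?m\<^sup>2 * s^4 * C))"
        by (intro Bochner_Integration.integrable_add integrable_mult_left gauss_norm2_integrable gauss_norm4_integrable)
      fix z :: "real^'n"
      have "norm (gauss z *\<^sub>R R (s *\<^sub>R z)) \<le> gauss z * ((?m * norm (s *\<^sub>R z))\<^sup>2 * (e + C * (norm (s *\<^sub>R z))\<^sup>2))"
        using R[of "s *\<^sub>R z"] by (simp only: norm_scaleR abs_of_nonneg[OF gauss_nonneg]) (intro mult_left_mono gauss_nonneg)
      also have "\<dots> = gauss z * (norm z)\<^sup>2 * (?m\<^sup>2 * s\<^sup>2 * e) + gauss z * (norm z)^4 * (?m\<^sup>2 * s^4 * C)"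
        using s(1) by (simp add: power_mult_distrib algebra_simps eval_nat_numeral)
      finally show "norm (gauss z *\<^sub>R R (s *\<^sub>R z)) \<le> gauss z * (norm z)\<^sup>2 * (?m\<^sup>2 * s\<^sup>2 * e) + gauss z * (norm z)^4 * (?m\<^sup>2 * s^4 * C)" .
    qed
    also have "\<dots> = M2 * (?m\<^sup>2 * s\<^sup>2 * e) + M4 * (?m\<^sup>2 * s^4 * C)"
      by (subst Bochner_Integration.integral_add)
         (auto simp: M2_def M4_def intro!: integrable_mult_left gauss_norm2_integrable gauss_norm4_integrable)
    also have "\<dots> = h * (2 * D * ?m\<^sup>2 * e * M2 + h * (4 * D\<^sup>2 * ?m\<^sup>2 * C * M4))"
    proof -
      have "s^4 = (s\<^sup>2)\<^sup>2" by simp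
      then show ?thesis unfolding s(2) by (simp only: s(2)) (simp add: algebra_simps power2_eq_square)
    qed
    finally have n: "norm (heat_semigroup D h W x - W x - h *\<^sub>R (D *\<^sub>R ?L) x) \<le> h * (2 * D * ?m\<^sup>2 * e * M2 + h * (4 * D\<^sup>2 * ?m\<^sup>2 * C * M4))"
      unfolding eq .
    have "((heat_semigroup D h W - W) /\<^sub>R h) x - (D *\<^sub>R ?L) x = (heat_semigroup D h W x - W x - h *\<^sub>R (D *\<^sub>R ?L) x) /\<^sub>R h"
      using h by (simp add: algebra_simps)
    then show "dist (((heat_semigroup D h W - W) /\<^sub>R h) x) ((D *\<^sub>R ?L) x) \<le> 2 * D * ?m\<^sup>2 * e * M2 + h * (4 * D\<^sup>2 * ?m\<^sup>2 * C * M4)"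
      using n h by (simp add: dist_norm del: scaleR_bcontfun.rep_eq minus_bcontfun.rep_eq) (simp add: field_simps)
  qed
  have "((\<lambda>h. 2 * D * ?m\<^sup>2 * e * M2 + h * (4 * D\<^sup>2 * ?m\<^sup>2 * C * M4)) \<longlongrightarrow> 2 * D * ?m\<^sup>2 * e * M2 + 0 * (4 * D\<^sup>2 * ?m\<^sup>2 * C * M4)) (at_right 0)"
    by (intro tendsto_intros)
  from order_tendstoD(2)[OF this, of \<epsilon>] e2
  have "eventually (\<lambda>h. 2 * D * ?m\<^sup>2 * e * M2 + h * (4 * D\<^sup>2 * ?m\<^sup>2 * C * M4) < \<epsilon>) (at_right 0)" by simp
  moreover have "eventually (\<lambda>h::real. h > 0) (at_right 0)" by (simp add: eventually_at_filter)
  ultimately show "eventually (\<lambda>h. dist ((heat_semigroup D h W - W) /\<^sub>R h) (D *\<^sub>R ?L) < \<epsilon>) (at_right 0)"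
    by eventually_elim (use est in fastforce)
qed

end

theory Submission
  imports Defs
begin

text \<open>The proof rests on an invariance property and on a contraction.

  The invariance is pointwise: if \<open>A\<close> has Frobenius norm at most \<open>\<surd>m\<close>, then \<open>\<kappa> A + f(A)\<close> has norm
  at most \<open>\<kappa> \<surd>m\<close> (\<open>norm_reaction_le\<close>). With \<open>B = A\<^sup>T A - 1\<close> one has \<open>\<kappa> A + f(A) = \<kappa> A - A B\<close> and
  \<open>\<langle>A, A B\<rangle> = |B|\<^sup>2 + |A|\<^sup>2 - m\<close>, while \<open>|A B|\<^sup>2 \<le> m |B|\<^sup>2 \<le> 2 \<kappa> |B|\<^sup>2\<close>; expanding the square, the
  terms in \<open>B\<close> have the right sign and what remains is \<open>\<kappa> (\<kappa> - 2) |A|\<^sup>2 + 2 \<kappa> m \<le> \<kappa>\<^sup>2 m\<close>. This is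
  where the lower bounds on \<open>\<kappa>\<close> enter: \<open>\<kappa> \<ge> 2\<close> for the last step, and \<open>2 \<kappa> \<ge> m\<close> before.

  Because the heat semigroup is contractive in the maximum norm, this bound makes the right-hand
  side of Duhamel's formula at time \<open>t\<close> at most
  \<open>e\<^bsup>-\<kappa>t\<^esup> \<surd>m + \<integral>\<^sub>0\<^sup>t e\<^bsup>-\<kappa>(t-s)\<^esup> \<kappa> \<surd>m ds = \<surd>m\<close>, so Duhamel's map preserves the closed set of continuous
  functions on \<open>[0,T]\<close> with values in the ball (\<open>duhamel_in_state_ball\<close>). On this ball the
  nonlinearity is Lipschitz continuous with some constant \<open>L\<close>, and for the norm
  \<open>sup\<^sub>t e\<^bsup>-Lt\<^esup> |U(t)|\<close> the map is a contraction with factor \<open>L / (\<kappa> + L)\<close>, however large \<open>T\<close> is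
  (\<open>duhamel_diff_le\<close>). One application of Banach's fixed point theorem therefore yields existence
  and uniqueness on all of \<open>[0,T]\<close> at once.
  This second part is carried out for an abstract family of contractions in a Banach space
  (\<open>unique_mild_solution\<close>).\<close>


section \<open>The reaction term maps the Frobenius ball into a multiple of itself\<close>

lemma norm_vec_squared: "(norm (x :: 'b::real_normed_vector^'n))\<^sup>2 = (\<Sum>i\<in>UNIV. (norm (x $ i))\<^sup>2)"
  by (simp add: norm_vec_def L2_set_def sum_nonneg)

lemma norm_transpose: "norm (transpose A) = norm (A :: real^'n^'m)"
  unfolding norm_matrix_eq_Frobenius by (subst sum.swap) (simp add: transpose_def)

text \<open>Left multiplication by \<open>A\<close> and by its transpose are adjoint for the Frobenius inner product
  \<open>tr (B\<^sup>T C)\<close>, which is the inner product of the type of matrices.\<close>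

lemma inner_matrix_mult_left:
  fixes A :: "real^'k^'m" and B :: "real^'n^'k"
  shows "(A ** B) \<bullet> C = B \<bullet> (transpose A ** C)"
proof -
  have "(A ** B) \<bullet> C = (\<Sum>i\<in>UNIV. \<Sum>j\<in>UNIV. \<Sum>k\<in>UNIV. A $ i $ k * B $ k $ j * C $ i $ j)"
    by (simp add: inner_vec_def matrix_matrix_mult_def sum_distrib_right)
  also have "\<dots> = (\<Sum>i\<in>UNIV. \<Sum>k\<in>UNIV. \<Sum>j\<in>UNIV. A $ i $ k * B $ k $ j * C $ i $ j)"
    by (intro sum.cong refl sum.swap)
  also have "\<dots> = (\<Sum>k\<in>UNIV. \<Sum>i\<in>UNIV. \<Sum>j\<in>UNIV. A $ i $ k * B $ k $ j * C $ i $ j)"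
    by (rule sum.swap)
  also have "\<dots> = (\<Sum>k\<in>UNIV. \<Sum>j\<in>UNIV. \<Sum>i\<in>UNIV. A $ i $ k * B $ k $ j * C $ i $ j)"
    by (intro sum.cong refl sum.swap)
  also have "\<dots> = B \<bullet> (transpose A ** C)"
    by (simp add: inner_vec_def matrix_matrix_mult_def transpose_def sum_distrib_left mult_ac)
  finally show ?thesis .
qed

text \<open>Every entry of \<open>A ** B\<close> is the inner product of a row of \<open>A\<close> with a column of \<open>B\<close>, so
  the Cauchy--Schwarz inequality can be applied entry by entry and summed.\<close>

lemma norm_matrix_mult_le:
  fixes A :: "real^'k^'m" and B :: "real^'n^'k"
  shows "norm (A ** B) \<le> norm A * norm B"
proof (rule power2_le_imp_le)
  have "((A ** B) $ i $ j)\<^sup>2 \<le> (norm (A $ i))\<^sup>2 * (norm (transpose B $ j))\<^sup>2" for i j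
  proof -
    have "(A ** B) $ i $ j = A $ i \<bullet> transpose B $ j"
      by (simp add: matrix_matrix_mult_def transpose_def inner_vec_def)
    then show ?thesis
      using Cauchy_Schwarz_ineq[of "A $ i" "transpose B $ j"] by (simp add: power2_norm_eq_inner)
  qed
  then have "(norm (A ** B))\<^sup>2 \<le> (\<Sum>i\<in>UNIV. \<Sum>j\<in>UNIV. (norm (A $ i))\<^sup>2 * (norm (transpose B $ j))\<^sup>2)"
    by (simp add: norm_vec_squared[of "A ** B"] norm_vec_squared[of "(A ** B) $ _"] sum_mono)
  also have "\<dots> = (norm A)\<^sup>2 * (norm (transpose B))\<^sup>2"
    by (simp add: norm_vec_squared[of A] norm_vec_squared[of "transpose B"] sum_product)
  finally show "(norm (A ** B))\<^sup>2 \<le> (norm A * norm B)\<^sup>2"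
    by (simp add: norm_transpose power_mult_distrib)
qed simp

lemma matrix_diff_ldistrib: "A ** (B - C) = A ** B - A ** (C :: 'a::ring_1^'n^'k)"
  by (simp add: matrix_matrix_mult_def vec_eq_iff right_diff_distrib sum_subtractf)

lemma matrix_diff_rdistrib: "(A - B) ** C = A ** C - B ** (C :: 'a::ring_1^'n^'k)"
  by (simp add: matrix_matrix_mult_def vec_eq_iff left_diff_distrib sum_subtractf)

lemma norm_mat_1: "(norm (mat 1 :: real^'n^'n))\<^sup>2 = real CARD('n)"
proof -
  have "(\<Sum>j\<in>UNIV. ((mat 1 :: real^'n^'n) $ i $ j)\<^sup>2) = 1" for i
    by (simp add: mat_def if_distrib[of "\<lambda>x. x\<^sup>2"] cong: if_cong)
  then show ?thesis by (simp add: norm_matrix_eq_Frobenius sum_nonneg)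
qed

text \<open>In terms of the squared singular values \<open>s\<close> of \<open>A\<close> the left-hand side squared is the sum of
  \<open>s (\<kappa> + 1 - s)\<^sup>2\<close>. Below its tangent at \<open>s = 1\<close> this cubic stays by
  \<open>\<kappa>\<^sup>2 + \<kappa> (\<kappa> - 2) (s - 1) - s (\<kappa> + 1 - s)\<^sup>2 = (s - 1)\<^sup>2 (2 \<kappa> - s)\<close>, which is nonnegative
  because \<open>s \<le> m \<le> 2 \<kappa>\<close>; and the tangent has slope \<open>\<kappa> (\<kappa> - 2) \<ge> 0\<close>, so summing it over \<open>m\<close>
  numbers with total at most \<open>m\<close> gives at most \<open>m \<kappa>\<^sup>2\<close>. The proof carries this out without
  diagonalizing: with \<open>B = A\<^sup>T A - 1\<close> the sum of \<open>(s - 1)\<^sup>2\<close> is the squared norm of \<open>B\<close>, and the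
  sum of \<open>(s - 1)\<^sup>2 s\<close> is that of \<open>A B\<close>.\<close>

lemma norm_reaction_le:
  fixes A :: "real^'n^'n"
  assumes A: "norm A \<le> sqrt (real CARD('n))" and \<kappa>: "2 \<le> \<kappa>" "real CARD('n) \<le> 2 * \<kappa>"
  shows "norm (\<kappa> *\<^sub>R A + f_AC A) \<le> \<kappa> * sqrt (real CARD('n))"
proof (rule power2_le_imp_le)
  let ?m = "real CARD('n)"
  define B where "B = transpose A ** A - mat 1"
  have A2: "(norm A)\<^sup>2 \<le> ?m" using A power_mono[OF A, of 2] by simp
  have eq: "\<kappa> *\<^sub>R A + f_AC A = \<kappa> *\<^sub>R A - A ** B"
    by (simp add: f_AC_def B_def matrix_diff_ldistrib matrix_mul_assoc)
  have "A \<bullet> (A ** B) = B \<bullet> (B + mat 1)"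
    unfolding inner_commute[of A "A ** B"] inner_matrix_mult_left by (simp add: B_def)
  moreover have "B \<bullet> mat 1 = (norm A)\<^sup>2 - ?m"
    using inner_matrix_mult_left[of A "mat 1" A] inner_commute[of "mat 1" "transpose A ** A"]
    unfolding norm_mat_1[symmetric] power2_norm_eq_inner by (simp add: B_def inner_diff_left)
  ultimately have AB: "A \<bullet> (A ** B) = (norm B)\<^sup>2 + (norm A)\<^sup>2 - ?m"
    by (simp add: inner_add_right power2_norm_eq_inner)
  have "(norm (A ** B))\<^sup>2 \<le> (norm A)\<^sup>2 * (norm B)\<^sup>2"
    using power_mono[OF norm_matrix_mult_le[of A B], of 2] by (simp add: power_mult_distrib)
  also have "\<dots> \<le> (2 * \<kappa>) * (norm B)\<^sup>2"
    using A2 \<kappa> by (intro mult_right_mono) auto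
  finally have nAB: "(norm (A ** B))\<^sup>2 \<le> 2 * \<kappa> * (norm B)\<^sup>2" .
  have "(norm (\<kappa> *\<^sub>R A + f_AC A))\<^sup>2 = \<kappa>\<^sup>2 * (norm A)\<^sup>2 - 2 * \<kappa> * (A \<bullet> (A ** B)) + (norm (A ** B))\<^sup>2"
    unfolding eq power2_norm_eq_inner
    by (simp add: inner_diff_left inner_diff_right inner_commute) (simp add: power2_eq_square)
  also have "\<dots> \<le> \<kappa>\<^sup>2 * (norm A)\<^sup>2 - 2 * \<kappa> * ((norm A)\<^sup>2 - ?m)"
    using nAB by (simp add: AB algebra_simps)
  also have "\<dots> = \<kappa> * (\<kappa> - 2) * (norm A)\<^sup>2 + 2 * \<kappa> * ?m"
    by (simp add: algebra_simps power2_eq_square)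
  also have "\<dots> \<le> \<kappa> * (\<kappa> - 2) * ?m + 2 * \<kappa> * ?m"
    using A2 \<kappa> by (intro add_right_mono mult_left_mono) auto
  also have "\<dots> = (\<kappa> * sqrt ?m)\<^sup>2"
    by (simp add: algebra_simps power2_eq_square)
  finally show "(norm (\<kappa> *\<^sub>R A + f_AC A))\<^sup>2 \<le> (\<kappa> * sqrt ?m)\<^sup>2" .
  show "0 \<le> \<kappa> * sqrt ?m" using \<kappa> by simp
qed

text \<open>The difference telescopes by exchanging one of the three factors at a time.\<close>

lemma norm_cubic_diff_le:
  fixes A B :: "real^'n^'n"
  assumes "norm A \<le> r" "norm B \<le> r"
  shows "norm (A ** transpose A ** A - B ** transpose B ** B) \<le> 3 * r\<^sup>2 * norm (A - B)"
proof -
  have r: "0 \<le> r" using assms(1) norm_ge_zero order_trans by blast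
  have tr: "transpose A - transpose B = transpose (A - B)" by (simp add: transpose_def vec_eq_iff)
  have step: "norm (X ** Y ** Z) \<le> norm X * norm Y * norm Z" for X Y Z :: "real^'n^'n"
    by (meson norm_matrix_mult_le mult_right_mono norm_ge_zero order_trans)
  have "A ** transpose A ** A - B ** transpose B ** B =
      (A - B) ** transpose A ** A + B ** transpose (A - B) ** A + B ** transpose B ** (A - B)"
    by (simp add: tr[symmetric] matrix_diff_ldistrib matrix_diff_rdistrib)
  also have "norm \<dots> \<le> norm (A - B) * norm A * norm A + norm B * norm (A - B) * norm A
      + norm B * norm B * norm (A - B)"
    using step[of "A - B" "transpose A" A] step[of B "transpose (A - B)" A] step[of B "transpose B" "A - B"]
    by (intro norm_triangle_mono) (simp_all only: norm_transpose)
  also have "\<dots> \<le> norm (A - B) * r * r + r * norm (A - B) * r + r * r * norm (A - B)"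
    using assms r by (intro add_mono mult_mono mult_nonneg_nonneg) auto
  also have "\<dots> = 3 * r\<^sup>2 * norm (A - B)" by (simp add: power2_eq_square)
  finally show ?thesis .
qed


section \<open>Duhamel's equation for a strongly continuous family of contractions\<close>

lemma continuous_on_bcontfun_eval: "continuous_on A (\<lambda>v. apply_bcontfun v x)"
  by (rule lipschitz_on_continuous_on[of 1]) (auto intro!: lipschitz_onI dist_bounded)

text \<open>Riemann sums of the integrand lie in the subspace and approximate the integral.\<close>

lemma integral_in_closed_subspace:
  fixes f :: "real \<Rightarrow> 'a::banach"
  assumes P: "subspace P" "closed P" and f: "f integrable_on {a..b}" "\<And>x. x \<in> {a..b} \<Longrightarrow> f x \<in> P"
  shows "integral {a..b} f \<in> P"
proof -
  have "\<exists>y\<in>P. dist y (integral {a..b} f) < e" if "e > 0" for e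
  proof -
    from integrable_integral[OF f(1), unfolded has_integral_real, rule_format, OF that]
    obtain g where g: "gauge g" "\<forall>D. D tagged_division_of {a..b} \<and> g fine D \<longrightarrow>
        norm ((\<Sum>(x, k)\<in>D. measure lborel k *\<^sub>R f x) - integral {a..b} f) < e"
      by (elim exE conjE)
    obtain D where D: "D tagged_division_of {a..b}" "g fine D"
      using fine_division_exists_real[OF g(1)] .
    have "(\<Sum>(x, k)\<in>D. measure lborel k *\<^sub>R f x) \<in> P"
    proof (rule subspace_sum[OF P(1)])
      fix xk assume xk: "xk \<in> D"
      obtain x k where "xk = (x, k)" by fastforce
      with xk have "x \<in> {a..b}" by (intro tag_in_interval[OF D(1), of x k]) simp
      then show "(case xk of (x, k) \<Rightarrow> measure lborel k *\<^sub>R f x) \<in> P"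
        using \<open>xk = (x, k)\<close> by (simp add: subspace_scale[OF P(1)] f(2))
    qed
    moreover have "dist (\<Sum>(x, k)\<in>D. measure lborel k *\<^sub>R f x) (integral {a..b} f) < e"
      using g(2) D by (simp add: dist_norm)
    ultimately show ?thesis by (rule bexI[rotated])
  qed
  then show ?thesis by (intro iffD1[OF closed_approachable[OF P(2)]] allI impI)
qed

lemma exp_convolution_has_integral:
  fixes c t :: real
  assumes "c \<noteq> 0" "0 \<le> t"
  shows "((\<lambda>s. exp (- c * (t - s))) has_integral (1 - exp (- c * t)) / c) {0..t}"
proof -
  have "((\<lambda>s. exp (- c * (t - s))) has_integral
      exp (- c * (t - t)) / c - exp (- c * (t - 0)) / c) {0..t}"
    using assms
    by (intro fundamental_theorem_of_calculus)
      (auto intro!: derivative_eq_intros simp: has_real_derivative_iff_has_vector_derivative[symmetric])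
  then show ?thesis by (simp add: diff_divide_distrib)
qed

text \<open>The features of the equation that well-posedness depends on: a strongly continuous family of
  contractions \<open>S\<close> on a closed subspace \<open>P\<close>, and a source \<open>N\<close> that is Lipschitz continuous on the
  ball of radius \<open>R\<close> and maps it into the ball of radius \<open>\<kappa> R\<close>. The factor \<open>\<kappa>\<close> is the damping
  rate in Duhamel's formula; it compensates exactly for the growth that \<open>N\<close> allows.\<close>

locale contraction_evolution =
  fixes S :: "real \<Rightarrow> 'a::banach \<Rightarrow> 'a" and P :: "'a set" and N :: "'a \<Rightarrow> 'a"
    and \<kappa> R L :: real
  assumes P: "subspace P" "closed P"
    and S_in: "\<And>t W. 0 \<le> t \<Longrightarrow> W \<in> P \<Longrightarrow> S t W \<in> P"
    and S_norm: "\<And>t W. 0 \<le> t \<Longrightarrow> W \<in> P \<Longrightarrow> norm (S t W) \<le> norm W"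
    and S_diff: "\<And>t V W. 0 \<le> t \<Longrightarrow> V \<in> P \<Longrightarrow> W \<in> P \<Longrightarrow> S t (V - W) = S t V - S t W"
    and S_cont: "\<And>W. W \<in> P \<Longrightarrow> continuous_on {0..} (\<lambda>t. S t W)"
    and pos: "0 < \<kappa>" "0 < L"
    and N_in: "\<And>W. W \<in> P \<Longrightarrow> norm W \<le> R \<Longrightarrow> N W \<in> P"
    and N_norm: "\<And>W. W \<in> P \<Longrightarrow> norm W \<le> R \<Longrightarrow> norm (N W) \<le> \<kappa> * R"
    and N_lipschitz: "\<And>V W. V \<in> P \<Longrightarrow> norm V \<le> R \<Longrightarrow> W \<in> P \<Longrightarrow> norm W \<le> R \<Longrightarrow>
          norm (N V - N W) \<le> L * norm (V - W)"
begin

definition state_ball :: "'a set" where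
  "state_ball = {W \<in> P. norm W \<le> R}"

definition damped :: "real \<Rightarrow> 'a \<Rightarrow> 'a" where
  "damped t W = exp (- \<kappa> * t) *\<^sub>R S t W"

definition duhamel :: "'a \<Rightarrow> (real \<Rightarrow> 'a) \<Rightarrow> real \<Rightarrow> 'a" where
  "duhamel W U t = damped t W + integral {0..t} (\<lambda>s. damped (t - s) (N (U s)))"

definition mild_solution :: "real \<Rightarrow> 'a \<Rightarrow> (real \<Rightarrow> 'a) \<Rightarrow> bool" where
  "mild_solution T W U \<longleftrightarrow>
     continuous_on {0..T} U \<and> (\<forall>t\<in>{0..T}. U t \<in> state_ball) \<and> (\<forall>t\<in>{0..T}. U t = duhamel W U t)"

lemma closed_state_ball: "closed state_ball"
proof -
  have "state_ball = P \<inter> cball 0 R" by (auto simp: state_ball_def)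
  then show ?thesis using P by auto
qed

lemma damped_in: "0 \<le> t \<Longrightarrow> W \<in> P \<Longrightarrow> damped t W \<in> P"
  by (simp add: damped_def S_in subspace_scale P)

lemma norm_damped: "0 \<le> t \<Longrightarrow> W \<in> P \<Longrightarrow> norm (damped t W) \<le> exp (- \<kappa> * t) * norm W"
  by (simp add: damped_def S_norm)

lemma damped_diff: "0 \<le> t \<Longrightarrow> V \<in> P \<Longrightarrow> W \<in> P \<Longrightarrow> damped t (V - W) = damped t V - damped t W"
  by (simp add: damped_def S_diff scaleR_diff_right)

lemma N_continuous: "continuous_on state_ball N"
proof (rule lipschitz_on_continuous_on)
  show "L-lipschitz_on state_ball N"
    using pos by (intro lipschitz_onI) (simp_all add: state_ball_def dist_norm N_lipschitz)
qed

text \<open>Strong continuity is only continuity in time for a fixed vector. Since all \<open>S t\<close> are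
  contractions, moving the vector costs no more than the distance moved, whatever the time, and
  the two together give joint continuity.\<close>

lemma damped_joint_continuous:
  assumes a: "continuous_on D a" "\<And>p. p \<in> D \<Longrightarrow> 0 \<le> a p"
    and G: "continuous_on D G" "\<And>p. p \<in> D \<Longrightarrow> G p \<in> P"
  shows "continuous_on D (\<lambda>p. damped (a p) (G p))"
  unfolding damped_def
proof (intro continuous_intros a)
  show "continuous_on D (\<lambda>p. S (a p) (G p))"
    unfolding continuous_on_def
  proof
    fix q assume q: "q \<in> D"
    have "continuous_on D (\<lambda>p. S (a p) (G q))"
      using a by (intro continuous_on_compose2[OF S_cont[OF G(2)[OF q]] a(1)]) auto
    then have lim: "((\<lambda>p. S (a p) (G q)) \<longlongrightarrow> S (a q) (G q)) (at q within D)"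
      using q by (simp add: continuous_on_def)
    have "((\<lambda>p. G p - G q) \<longlongrightarrow> 0) (at q within D)"
      using G(1) q by (simp add: continuous_on_def LIM_zero)
    then have "((\<lambda>p. S (a p) (G p) - S (a p) (G q)) \<longlongrightarrow> 0) (at q within D)"
    proof (rule Lim_null_comparison[rotated, OF tendsto_norm_zero])
      show "\<forall>\<^sub>F p in at q within D. norm (S (a p) (G p) - S (a p) (G q)) \<le> norm (G p - G q)"
        unfolding eventually_at_filter
        using S_norm a(2) G(2) q P(1)
        by (intro always_eventually) (simp add: S_diff[symmetric] subspace_diff)
    qed
    from tendsto_add[OF this lim] show "((\<lambda>p. S (a p) (G p)) \<longlongrightarrow> S (a q) (G q)) (at q within D)"
      by simp
  qed
qed

lemma source_in: "W \<in> state_ball \<Longrightarrow> N W \<in> P"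
  by (simp add: state_ball_def N_in)

context
  fixes T :: real and U :: "real \<Rightarrow> 'a"
  assumes U: "continuous_on {0..T} U" "\<And>t. t \<in> {0..T} \<Longrightarrow> U t \<in> state_ball"
begin

lemma integrand_continuous:
  assumes "t \<in> {0..T}"
  shows "continuous_on {0..t} (\<lambda>s. damped (t - s) (N (U s)))"
  using assms
  by (intro damped_joint_continuous continuous_intros
        continuous_on_compose2[OF N_continuous continuous_on_subset[OF U(1)]])
     (auto intro!: source_in U(2))

text \<open>The substitution \<open>s = t r\<close> moves the integral to the fixed interval \<open>{0..1}\<close>, where it depends
  continuously on the parameter \<open>t\<close>.\<close>

lemma duhamel_continuous:
  assumes W: "W \<in> P"
  shows "continuous_on {0..T} (duhamel W U)"
proof -
  let ?F = "\<lambda>t r. t *\<^sub>R damped (t - t * r) (N (U (t * r)))"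
  have sub: "t * r \<le> t" "t * r \<in> {0..T}" if "t \<in> {0..T}" "r \<in> {0..1}" for t r
    using that mult_left_le[of r t] by auto
  have rescale: "integral {0..t} (\<lambda>s. damped (t - s) (N (U s))) = integral {0..1} (?F t)"
    if t: "t \<in> {0..T}" for t
  proof (cases "t = 0")
    case False
    let ?I = "integral {0..t} (\<lambda>s. damped (t - s) (N (U s)))"
    have "((\<lambda>s. damped (t - s) (N (U s))) has_integral ?I) {0..t}"
      using integrand_continuous[OF t] by (intro integrable_integral integrable_continuous_real)
    from has_integral_stretch_real[OF this False]
    have "((\<lambda>r. damped (t - t * r) (N (U (t * r)))) has_integral (1 / t) *\<^sub>R ?I) {0..1}"
      using False t by (simp add: image_divide_atLeastAtMost)
    from has_integral_cmul[OF this, of t] have "(?F t has_integral ?I) {0..1}"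
      using False by simp
    then show ?thesis by (rule integral_unique[symmetric])
  qed simp
  have "continuous_on ({0..T} \<times> {0..1}) (\<lambda>(t, r). ?F t r)"
    unfolding case_prod_beta
    by (intro continuous_intros damped_joint_continuous
          continuous_on_compose2[OF N_continuous continuous_on_compose2[OF U(1)]])
       (auto intro!: source_in U(2) sub simp: sub simp del: atLeastAtMost_iff)
  then have "continuous_on {0..T} (\<lambda>t. integral {0..1} (?F t))"
    using integral_continuous_on_param[of "{0..T}" 0 1 ?F] by simp
  then have "continuous_on {0..T} (\<lambda>t. integral {0..t} (\<lambda>s. damped (t - s) (N (U s))))"
    by (subst continuous_on_cong[OF refl rescale])
  moreover have "continuous_on {0..T} (\<lambda>t. damped t W)"
    by (intro damped_joint_continuous continuous_intros W) auto
  ultimately show ?thesis unfolding duhamel_def[abs_def] by (intro continuous_on_add)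
qed

text \<open>The bound \<open>\<kappa> R\<close> on the source is balanced by the damping:
  \<open>e\<^bsup>-\<kappa>t\<^esup> R + \<integral>\<^sub>0\<^sup>t e\<^bsup>-\<kappa>(t-s)\<^esup> \<kappa> R ds = R\<close>.\<close>

lemma duhamel_in_state_ball:
  assumes W: "W \<in> state_ball" and t: "t \<in> {0..T}"
  shows "duhamel W U t \<in> state_ball"
proof -
  let ?f = "\<lambda>s. damped (t - s) (N (U s))"
  have W': "W \<in> P" "norm W \<le> R" using W by (auto simp: state_ball_def)
  have sub: "0 \<le> t - s" "U s \<in> P" "norm (U s) \<le> R" if "s \<in> {0..t}" for s
    using that t U(2)[of s] by (auto simp: state_ball_def)
  have int: "?f integrable_on {0..t}"
    by (intro integrable_continuous_real integrand_continuous t)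
  have exp_int: "((\<lambda>s. exp (- \<kappa> * (t - s)) * (\<kappa> * R)) has_integral (1 - exp (- \<kappa> * t)) / \<kappa> * (\<kappa> * R)) {0..t}"
    using pos t by (intro has_integral_mult_left exp_convolution_has_integral) auto
  have "norm (integral {0..t} ?f) \<le> integral {0..t} (\<lambda>s. exp (- \<kappa> * (t - s)) * (\<kappa> * R))"
  proof (rule Henstock_Kurzweil_Integration.integral_norm_bound_integral[OF int])
    fix s assume s: "s \<in> {0..t}"
    show "norm (?f s) \<le> exp (- \<kappa> * (t - s)) * (\<kappa> * R)"
      using norm_damped[OF sub(1)[OF s] N_in[OF sub(2,3)[OF s]]] N_norm[OF sub(2,3)[OF s]]
      by (meson exp_ge_zero mult_left_mono order_trans)
  qed (use exp_int in blast)
  also have "\<dots> = (1 - exp (- \<kappa> * t)) * R"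
    using integral_unique[OF exp_int] pos by simp
  finally have "norm (duhamel W U t) \<le> exp (- \<kappa> * t) * R + (1 - exp (- \<kappa> * t)) * R"
    unfolding duhamel_def
    using t by (intro norm_triangle_mono order_trans[OF norm_damped] mult_left_mono W') auto
  moreover have "duhamel W U t \<in> P"
    unfolding duhamel_def
    by (intro subspace_add P damped_in integral_in_closed_subspace int W' N_in sub)
       (use t in auto)
  ultimately show ?thesis by (simp add: state_ball_def algebra_simps)
qed

end

text \<open>The weight \<open>exp (L * t)\<close> makes Duhamel's map a contraction on an interval of any length: the
  increment of the integral is at most
  \<open>\<integral>\<^sub>0\<^sup>t e\<^bsup>-\<kappa>(t-s)\<^esup> L e\<^bsup>Ls\<^esup> d ds = e\<^bsup>Lt\<^esup> L d \<integral>\<^sub>0\<^sup>t e\<^bsup>-(\<kappa>+L)(t-s)\<^esup> ds\<close>, and the last integral is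
  below \<open>1 / (\<kappa> + L)\<close>.\<close>

lemma duhamel_diff_le:
  assumes U: "continuous_on {0..T} U" "\<And>t. t \<in> {0..T} \<Longrightarrow> U t \<in> state_ball"
    and V: "continuous_on {0..T} V" "\<And>t. t \<in> {0..T} \<Longrightarrow> V t \<in> state_ball"
    and d: "\<And>t. t \<in> {0..T} \<Longrightarrow> norm (U t - V t) \<le> exp (L * t) * d"
    and t: "t \<in> {0..T}"
  shows "norm (duhamel W U t - duhamel W V t) \<le> exp (L * t) * (L / (\<kappa> + L) * d)"
proof -
  let ?f = "\<lambda>U s. damped (t - s) (N (U s))" and ?c = "\<kappa> + L"
  have d0: "0 \<le> d" using order_trans[OF norm_ge_zero d[OF t]] by (simp add: zero_le_mult_iff)
  have int: "?f U integrable_on {0..t}" "?f V integrable_on {0..t}"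
    by (intro integrable_continuous_real integrand_continuous[OF _ _ t] U V; assumption)+
  have exp_int: "((\<lambda>s. exp (L * t) * L * d * exp (- ?c * (t - s))) has_integral
      exp (L * t) * L * d * ((1 - exp (- ?c * t)) / ?c)) {0..t}"
    using pos t by (intro has_integral_mult_right exp_convolution_has_integral) auto
  have "norm (integral {0..t} (\<lambda>s. ?f U s - ?f V s)) \<le>
      integral {0..t} (\<lambda>s. exp (L * t) * L * d * exp (- ?c * (t - s)))"
  proof (rule Henstock_Kurzweil_Integration.integral_norm_bound_integral)
    show "(\<lambda>s. ?f U s - ?f V s) integrable_on {0..t}"
      using int by (rule Henstock_Kurzweil_Integration.integrable_diff)
    show "(\<lambda>s. exp (L * t) * L * d * exp (- ?c * (t - s))) integrable_on {0..t}"
      using exp_int by (rule has_integral_integrable)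
    fix s assume s: "s \<in> {0..t}"
    then have s': "s \<in> {0..T}" "0 \<le> t - s" using t by auto
    have K: "U s \<in> P" "norm (U s) \<le> R" "V s \<in> P" "norm (V s) \<le> R"
      using U(2)[OF s'(1)] V(2)[OF s'(1)] by (auto simp: state_ball_def)
    have "norm (?f U s - ?f V s) \<le> exp (- \<kappa> * (t - s)) * norm (N (U s) - N (V s))"
      using norm_damped[of "t - s" "N (U s) - N (V s)"] K s'(2)
      by (simp only: damped_diff N_in subspace_diff[OF P(1)])
    also have "\<dots> \<le> exp (- \<kappa> * (t - s)) * (L * (exp (L * s) * d))"
      using pos by (intro mult_left_mono order_trans[OF N_lipschitz[OF K]] d s'(1)) auto
    also have "\<dots> = (exp (- \<kappa> * (t - s)) * exp (L * s)) * (L * d)"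
      by (simp only: mult_ac)
    also have "exp (- \<kappa> * (t - s)) * exp (L * s) = exp (L * t) * exp (- ?c * (t - s))"
      by (simp add: exp_add[symmetric] algebra_simps)
    finally show "norm (?f U s - ?f V s) \<le> exp (L * t) * L * d * exp (- ?c * (t - s))"
      by (simp add: mult_ac)
  qed
  also have "\<dots> = exp (L * t) * L * d * ((1 - exp (- ?c * t)) / ?c)"
    using exp_int by (rule integral_unique)
  also have "\<dots> \<le> exp (L * t) * L * d * (1 / ?c)"
    using pos d0 by (intro mult_left_mono divide_right_mono) auto
  finally show ?thesis
    by (simp add: duhamel_def Henstock_Kurzweil_Integration.integral_diff[OF int])
qed

text \<open>Banach's theorem is applied to \<open>v t = exp (- L * t) *\<^sub>R U t\<close> instead of \<open>U\<close>, so that the weighted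
  norm becomes the supremum norm of bounded continuous functions. Functions on \<open>{0..T}\<close> are
  extended to the whole line by their boundary values; a fixed point is such an extension
  automatically, so that fixed points and solutions on \<open>{0..T}\<close> correspond to each other.\<close>

theorem unique_mild_solution:
  assumes W: "W \<in> state_ball" and T: "0 \<le> T"
  shows "\<exists>U. mild_solution T W U \<and> (\<forall>V. mild_solution T W V \<longrightarrow> (\<forall>t\<in>{0..T}. V t = U t))"
proof -
  define U where "U v t = exp (L * t) *\<^sub>R apply_bcontfun v t" for v :: "real \<Rightarrow>\<^sub>C 'a" and t
  define M where "M = {v. \<forall>t\<in>{0..T}. U v t \<in> state_ball}"
  have U_cont: "continuous_on A (U v)" for A v
    unfolding U_def by (intro continuous_intros) auto
  \<comment> \<open>how a function on \<open>{0..T}\<close> is stored as an element of the Banach space\<close>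
  have pack: "\<exists>v. \<forall>t. apply_bcontfun v t = exp (- L * clamp 0 T t) *\<^sub>R V (clamp 0 T t)"
    if "continuous_on {0..T} V" for V :: "real \<Rightarrow> 'a"
  proof -
    have "continuous_on (cbox 0 T) (\<lambda>t. exp (- L * t) *\<^sub>R V t)"
      using that by (auto intro!: continuous_intros)
    then show ?thesis by (rule continuous_on_cbox_bcontfunE) metis
  qed
  have clamp: "clamp 0 T t \<in> {0..T}" for t :: real
    using clamp_in_interval[of 0 T t] T by simp
  have clamp_id: "clamp 0 T t = t" if "t \<in> {0..T}" for t :: real
    using clamp_cancel_cbox[of t 0 T] that by simp
  have "\<exists>w. \<forall>t. apply_bcontfun w t = exp (- L * clamp 0 T t) *\<^sub>R duhamel W (U v) (clamp 0 T t)" 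
    if "v \<in> M" for v
    using that W by (intro pack duhamel_continuous U_cont) (auto simp: M_def state_ball_def)
  then obtain \<Psi> where \<Psi>: "\<And>v t. v \<in> M \<Longrightarrow>
      apply_bcontfun (\<Psi> v) t = exp (- L * clamp 0 T t) *\<^sub>R duhamel W (U v) (clamp 0 T t)"
    by metis
  have U\<Psi>: "U (\<Psi> v) t = duhamel W (U v) t" if "v \<in> M" "t \<in> {0..T}" for v t
    using that by (simp add: U_def \<Psi> clamp_id exp_minus)
  have "\<exists>!v\<in>M. \<Psi> v = v"
  proof (rule Banach_fix[OF complete_eq_closed[THEN iffD2]])
    show "closed M"
    proof -
      have "closed {v. U v t \<in> state_ball}" for t
      proof -
        have "continuous_on UNIV (\<lambda>v. U v t)"
          unfolding U_def by (intro continuous_intros continuous_on_bcontfun_eval)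
        from closed_vimage[OF closed_state_ball this] show ?thesis by (simp add: vimage_def)
      qed
      moreover have "M = (\<Inter>t\<in>{0..T}. {v. U v t \<in> state_ball})" by (auto simp: M_def)
      ultimately show ?thesis by auto
    qed
    obtain v where v: "\<And>t. apply_bcontfun v t = exp (- L * clamp 0 T t) *\<^sub>R W"
      using pack[of "\<lambda>_. W"] by auto
    have "v \<in> M" using W by (simp add: M_def U_def v clamp_id exp_minus)
    then show "M \<noteq> {}" by blast
    show "0 \<le> L / (\<kappa> + L)" "L / (\<kappa> + L) < 1" using pos by auto
    show "\<Psi> ` M \<subseteq> M"
    proof
      fix w assume "w \<in> \<Psi> ` M"
      then obtain v where v: "v \<in> M" "w = \<Psi> v" by blast
      have "U w t \<in> state_ball" if "t \<in> {0..T}" for t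
        unfolding v(2) U\<Psi>[OF v(1) that]
        by (rule duhamel_in_state_ball[OF U_cont _ W that]) (use v(1) in \<open>simp add: M_def\<close>)
      then show "w \<in> M" by (simp add: M_def)
    qed
    fix v w assume vw: "v \<in> M" "w \<in> M"
    show "dist (\<Psi> v) (\<Psi> w) \<le> L / (\<kappa> + L) * dist v w"
    proof (rule dist_bound)
      fix t
      let ?s = "clamp 0 T t"
      have d: "norm (U v r - U w r) \<le> exp (L * r) * dist v w" for r
      proof -
        have "U v r - U w r = exp (L * r) *\<^sub>R (v r - w r)"
          by (simp add: U_def scaleR_diff_right)
        then show ?thesis using dist_bounded[of v r w] by (simp add: dist_norm)
      qed
      have "norm (duhamel W (U v) ?s - duhamel W (U w) ?s) \<le> exp (L * ?s) * (L / (\<kappa> + L) * dist v w)"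
        by (rule duhamel_diff_le[OF U_cont _ U_cont _ d clamp]) (use vw in \<open>simp_all add: M_def\<close>)
      then have "exp (- L * ?s) * norm (duhamel W (U v) ?s - duhamel W (U w) ?s) \<le>
          exp (- L * ?s) * (exp (L * ?s) * (L / (\<kappa> + L) * dist v w))"
        by (intro mult_left_mono) auto
      moreover have "\<Psi> v t - \<Psi> w t = exp (- L * ?s) *\<^sub>R (duhamel W (U v) ?s - duhamel W (U w) ?s)"
        using vw by (simp add: \<Psi> scaleR_diff_right)
      moreover have "exp (- L * ?s) * exp (L * ?s) = 1"
        by (simp add: exp_add[symmetric])
      ultimately show "dist (\<Psi> v t) (\<Psi> w t) \<le> L / (\<kappa> + L) * dist v w"
        by (simp add: dist_norm mult.assoc[symmetric])
    qed
  qed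
  then obtain v where v: "v \<in> M" "\<Psi> v = v" and uniq: "\<And>w. w \<in> M \<Longrightarrow> \<Psi> w = w \<Longrightarrow> w = v" by blast
  have "mild_solution T W (U v)"
    unfolding mild_solution_def using v U\<Psi>[OF v(1)] U_cont by (auto simp: M_def)
  moreover have "V t = U v t" if V: "mild_solution T W V" and t: "t \<in> {0..T}" for V t
  proof -
    obtain w where w: "\<And>t. apply_bcontfun w t = exp (- L * clamp 0 T t) *\<^sub>R V (clamp 0 T t)"
      using pack[of V] V by (auto simp: mild_solution_def)
    have Uw: "U w s = V s" if "s \<in> {0..T}" for s
      using that by (simp add: U_def w clamp_id exp_minus)
    have "\<forall>s\<in>{0..T}. V s \<in> state_ball" using V unfolding mild_solution_def by blast
    then have wM: "w \<in> M" by (simp add: M_def Uw)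
    have "\<Psi> w = w"
    proof (rule bcontfun_eqI)
      fix t
      let ?s = "clamp 0 T t"
      have "duhamel W (U w) ?s = duhamel W V ?s"
        unfolding duhamel_def using clamp[of t]
        by (intro arg_cong2[where f="(+)"] refl Henstock_Kurzweil_Integration.integral_cong) (simp add: Uw)
      then show "\<Psi> w t = w t"
        using V clamp[of t] by (simp add: \<Psi>[OF wM] w mild_solution_def)
    qed
    then show ?thesis using uniq[OF wM] Uw[OF t] by simp
  qed
  ultimately show ?thesis by blast
qed

end


section \<open>The matrix-valued Allen--Cahn equation\<close>

instance bcontfun :: (metric_space, banach) banach ..

lemma subspace_periodic_space: "subspace periodic_space"
  by (auto simp: subspace_def periodic_space_def)

lemma closed_periodic_space:
  "closed (periodic_space :: ((real^'n) \<Rightarrow>\<^sub>C 'b::euclidean_space) set)"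
proof -
  have "periodic_space = (\<Inter>x. \<Inter>i.
      {W :: (real^'n) \<Rightarrow>\<^sub>C 'b. apply_bcontfun W (x + axis i 1) = apply_bcontfun W x})"
    by (auto simp: periodic_space_def)
  also have "closed \<dots>"
    by (intro closed_INT ballI closed_Collect_eq continuous_on_bcontfun_eval)
  finally show ?thesis .
qed

text \<open>By periodicity the pointwise bound on the cell is a bound on the whole space.\<close>

lemma Xm_eq_ball: "(Xm :: ((real^'n) \<Rightarrow>\<^sub>C (real^'n^'n)) set) =
    {W \<in> periodic_space. norm W \<le> sqrt (real CARD('n))}"
proof -
  have "norm W \<le> sqrt (real CARD('n))"
    if "W \<in> periodic_space" "\<forall>x\<in>Omega. norm (W x) \<le> sqrt (real CARD('n))"
    for W :: "(real^'n) \<Rightarrow>\<^sub>C (real^'n^'n)"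
  proof -
    have "(0::real^'n) \<in> Omega" by (simp add: Omega_def mem_box_cart)
    then show ?thesis
      unfolding norm_periodic[OF that(1)] using that(2) by (intro cSUP_least) auto
  qed
  then show ?thesis by (auto simp: Xm_def intro: order_trans[OF norm_bounded])
qed

lemma nonlin_periodic: "W \<in> periodic_space \<Longrightarrow> nonlin \<kappa> W \<in> periodic_space"
  by (simp add: periodic_space_def nonlin_apply)

lemma norm_nonlin_le:
  fixes W :: "(real^'n) \<Rightarrow>\<^sub>C (real^'n^'n)"
  assumes "norm W \<le> sqrt (real CARD('n))" "2 \<le> \<kappa>" "real CARD('n) \<le> 2 * \<kappa>"
  shows "norm (nonlin \<kappa> W) \<le> \<kappa> * sqrt (real CARD('n))"
  using assms
  by (intro norm_bound) (simp add: nonlin_apply norm_reaction_le order_trans[OF norm_bounded])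

lemma nonlin_lipschitz:
  fixes V W :: "(real^'n) \<Rightarrow>\<^sub>C (real^'n^'n)"
  assumes "0 \<le> \<kappa>" and V: "norm V \<le> r" and W: "norm W \<le> r"
  shows "norm (nonlin \<kappa> V - nonlin \<kappa> W) \<le> (\<kappa> + 1 + 3 * r\<^sup>2) * norm (V - W)"
proof (rule norm_bound)
  fix x
  let ?c = "\<lambda>A :: real^'n^'n. A ** transpose A ** A"
  have "(nonlin \<kappa> V - nonlin \<kappa> W) x = (\<kappa> + 1) *\<^sub>R (V x - W x) - (?c (V x) - ?c (W x))"
    by (simp add: nonlin_apply f_AC_def algebra_simps)
  also have "norm \<dots> \<le> (\<kappa> + 1) * norm (V x - W x) + 3 * r\<^sup>2 * norm (V x - W x)"
    using \<open>0 \<le> \<kappa>\<close> order_trans[OF norm_bounded V] order_trans[OF norm_bounded W]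
    by (intro order_trans[OF norm_triangle_ineq4] add_mono norm_cubic_diff_le) simp_all
  also have "\<dots> = (\<kappa> + 1 + 3 * r\<^sup>2) * norm ((V - W) x)"
    by (simp add: algebra_simps)
  also have "\<dots> \<le> (\<kappa> + 1 + 3 * r\<^sup>2) * norm (V - W)"
    using \<open>0 \<le> \<kappa>\<close> by (intro mult_left_mono norm_bounded) auto
  finally show "norm ((nonlin \<kappa> V - nonlin \<kappa> W) x) \<le> (\<kappa> + 1 + 3 * r\<^sup>2) * norm (V - W)" .
qed

theorem theorem2p5:
  fixes \<epsilon> \<kappa> T :: real
    and U\<^sub>0 :: "(real^'n) \<Rightarrow>\<^sub>C (real^'n^'n)"
  assumes m: "CARD('n) \<ge> 2"
    and "\<epsilon> > 0" and "\<kappa> > 0" and "T > 0"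
    and U0: "U\<^sub>0 \<in> Xm"
    and kappa: "\<kappa> \<ge> max (3 / 2 * real CARD('n) - 1) 2"
  shows "\<exists>U. AC_solution \<epsilon> \<kappa> T U\<^sub>0 U \<and>
             (\<forall>t\<in>{0..T}. \<forall>x\<in>Omega. norm (U t x) \<le> sqrt (real CARD('n))) \<and>
             (\<forall>V. AC_solution \<epsilon> \<kappa> T U\<^sub>0 V \<longrightarrow> (\<forall>t\<in>{0..T}. V t = U t))"
proof -
  let ?r = "sqrt (real CARD('n))"
  \<comment> \<open>\<open>2 \<kappa> \<ge> 3 m - 2 \<ge> m\<close>\<close>
  have \<kappa>: "2 \<le> \<kappa>" "real CARD('n) \<le> 2 * \<kappa>" using kappa m by auto
  have D: "\<epsilon>\<^sup>2 > 0" using \<open>\<epsilon> > 0\<close> by simp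
  have diff: "heat_semigroup (\<epsilon>\<^sup>2) t (V - W) = heat_semigroup (\<epsilon>\<^sup>2) t V - heat_semigroup (\<epsilon>\<^sup>2) t W"
    if "0 \<le> t" for t and V W :: "(real^'n) \<Rightarrow>\<^sub>C (real^'n^'n)"
    using heat_semigroup_linear[OF D that, of 1 V "-1" W] by simp
  interpret contraction_evolution "heat_semigroup (\<epsilon>\<^sup>2)"
    "periodic_space :: ((real^'n) \<Rightarrow>\<^sub>C (real^'n^'n)) set" "nonlin \<kappa>" \<kappa> ?r "\<kappa> + 1 + 3 * ?r\<^sup>2"
  proof
    show "0 < \<kappa> + 1 + 3 * ?r\<^sup>2" using \<open>\<kappa> > 0\<close> by (simp add: add_pos_nonneg)
  qed (use \<open>\<kappa> > 0\<close> \<kappa> in \<open>simp_all add: subspace_periodic_space closed_periodic_space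
         diff heat_semigroup_periodic[OF D] heat_semigroup_norm[OF D] heat_semigroup_continuous[OF D]
         nonlin_periodic norm_nonlin_le nonlin_lipschitz del: real_sqrt_pow2\<close>)
  have ball_eq: "state_ball = Xm" by (simp add: state_ball_def Xm_eq_ball)
  have "damped = exp_L_minus \<epsilon> \<kappa>" by (simp add: fun_eq_iff damped_def exp_L_minus_def)
  then have mild_iff: "mild_solution T U\<^sub>0 U \<longleftrightarrow> AC_solution \<epsilon> \<kappa> T U\<^sub>0 U" for U
    by (simp add: mild_solution_def AC_solution_def duhamel_def ball_eq)
  obtain U where U: "AC_solution \<epsilon> \<kappa> T U\<^sub>0 U"
      "\<forall>V. AC_solution \<epsilon> \<kappa> T U\<^sub>0 V \<longrightarrow> (\<forall>t\<in>{0..T}. V t = U t)"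
    using unique_mild_solution[of U\<^sub>0 T, unfolded ball_eq mild_iff, OF U0] \<open>T > 0\<close> by auto
  have "\<forall>t\<in>{0..T}. U t \<in> Xm" using U(1) unfolding AC_solution_def by blast
  then have "norm (U t x) \<le> ?r" if "t \<in> {0..T}" "x \<in> Omega" for t x
    using that by (simp add: Xm_def)
  with U show ?thesis by (intro exI[of _ U] conjI ballI)
qed

end
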